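(* Let $M$ be a complete metric space. Let $X\subseteq\mathcal{F}(M)$ be a closed subspace which does not contain an isomorphic copy of $\ell_1$. Then there exists a compact $K\subset M$ such that $X$ is isomorphic to a subspace of $\mathcal{F}(K)$.
   Context: All metric spaces come with a distinguished base point $0$. $\mathrm{Lip}_0(M)$ is the Banach space of real-valued Lipschitz functions $f$ on $M$ with $f(0)=0$, normed by the best Lipschitz constant. For $x\in M$ let $\delta(x)\in\mathrm{Lip}_0(M)^*$ be $\delta(x)(f)=f(x)$. The Lipschitz-free space is $\mathcal{F}(M)=\overline{\operatorname{span}}\{\delta(x):x\in M\}\subset\mathrm{Lip}_0(M)^*$ (norm closure). For $N\subset M$, $\mathcal{F}(N)$ is identified with the closed subspace $\overline{\operatorname{span}}\{\delta(x):x\in N\}$ of $\mathcal{F}(M)$ (canonically isometric to the free space over $N\cup\{0\}$). "Isomorphic" means linearly homeomorphic. *)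

theory Defs
  imports "HOL-Analysis.Analysis"
begin

text \<open>
  A pointed metric space is a type of sort \<open>{metric_space, zero}\<close>. The class \<open>zero\<close> only
  provides a constant, without axioms; its value \<open>0\<close> is the distinguished base point.
\<close>

typedef (overloaded) ('a::"{metric_space, zero}") lip0 =
  "{f :: 'a \<Rightarrow> real. (\<exists>C. C-lipschitz_on UNIV f) \<and> f 0 = 0}"
  morphisms lip0_apply Abs_lip0
  by (rule exI[of _ "\<lambda>_. 0"]) (auto intro: lipschitz_on_constant)

setup_lifting type_definition_lip0

lemma lip0_eqI: "(\<And>x. lip0_apply f x = lip0_apply g x) \<Longrightarrow> f = g"
  by (metis ext lip0_apply_inject)

lemma lip0_apply_base [simp]: "lip0_apply f 0 = 0"
  using lip0_apply[of f] by auto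

definition best_lipschitz :: "('a::metric_space \<Rightarrow> real) \<Rightarrow> real" where
  "best_lipschitz f = Inf {C. C-lipschitz_on UNIV f}"

lemma bdd_below_lipschitz: "bdd_below {C. C-lipschitz_on UNIV f}"
  by (rule bdd_belowI[of _ 0]) (auto dest: lipschitz_on_nonneg)

lemma best_lipschitz_le: "C-lipschitz_on UNIV f \<Longrightarrow> best_lipschitz f \<le> C"
  unfolding best_lipschitz_def by (rule cInf_lower) (auto simp: bdd_below_lipschitz)

lemma best_lipschitz_lipschitz:
  assumes "\<exists>C. C-lipschitz_on UNIV f"
  shows "(best_lipschitz f)-lipschitz_on UNIV f"
proof (rule lipschitz_onI)
  have ne: "{C. C-lipschitz_on UNIV f} \<noteq> {}"
    using assms by auto
  show "0 \<le> best_lipschitz f"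
    unfolding best_lipschitz_def using ne
    by (rule cInf_greatest) (auto dest: lipschitz_on_nonneg)
  fix x y
  show "dist (f x) (f y) \<le> best_lipschitz f * dist x y"
  proof (cases "x = y")
    case False
    have "dist (f x) (f y) / dist x y \<le> best_lipschitz f"
      unfolding best_lipschitz_def using ne
      by (rule cInf_greatest) (use False in \<open>auto simp: divide_le_eq dest: lipschitz_onD\<close>)
    with False show ?thesis
      by (simp add: divide_le_eq)
  qed simp
qed

instantiation lip0 :: ("{metric_space, zero}") real_normed_vector
begin

lift_definition zero_lip0 :: "'a lip0" is "\<lambda>_. 0"
  by (auto intro: lipschitz_on_constant)

lift_definition plus_lip0 :: "'a lip0 \<Rightarrow> 'a lip0 \<Rightarrow> 'a lip0" is "\<lambda>f g x. f x + g x"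
  by (auto intro: lipschitz_on_add)

lift_definition uminus_lip0 :: "'a lip0 \<Rightarrow> 'a lip0" is "\<lambda>f x. - f x"
  by (auto simp: lipschitz_on_minus)

lift_definition minus_lip0 :: "'a lip0 \<Rightarrow> 'a lip0 \<Rightarrow> 'a lip0" is "\<lambda>f g x. f x - g x"
  by (auto intro: lipschitz_on_diff)

lift_definition scaleR_lip0 :: "real \<Rightarrow> 'a lip0 \<Rightarrow> 'a lip0" is "\<lambda>c f x. c * f x"
  by (auto intro: lipschitz_on_cmult_real)

lift_definition norm_lip0 :: "'a lip0 \<Rightarrow> real" is best_lipschitz .

definition dist_lip0 :: "'a lip0 \<Rightarrow> 'a lip0 \<Rightarrow> real" where
  "dist_lip0 f g = norm (f - g)"

definition sgn_lip0 :: "'a lip0 \<Rightarrow> 'a lip0" where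
  "sgn_lip0 f = inverse (norm f) *\<^sub>R f"

definition uniformity_lip0 :: "('a lip0 \<times> 'a lip0) filter" where
  "uniformity_lip0 = (INF e\<in>{0<..}. principal {(f, g). dist f g < e})"

definition open_lip0 :: "'a lip0 set \<Rightarrow> bool" where
  "open_lip0 U = (\<forall>f\<in>U. \<forall>\<^sub>F (f', g) in uniformity. f' = f \<longrightarrow> g \<in> U)"

instance
proof
  fix f g h :: "'a lip0" and a b c :: real
  have lip: "(norm f)-lipschitz_on UNIV (lip0_apply f)" for f :: "'a lip0"
    by transfer (auto intro: best_lipschitz_lipschitz)
  have norm_le: "norm f \<le> C" if "C-lipschitz_on UNIV (lip0_apply f)" for f :: "'a lip0" and C
    using that by transfer (auto intro: best_lipschitz_le)
  have nonneg: "0 \<le> norm f" for f :: "'a lip0"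
    using lip lipschitz_on_nonneg by blast
  have scale_le: "norm (c *\<^sub>R f) \<le> \<bar>c\<bar> * norm f" for c and f :: "'a lip0"
  proof (rule norm_le)
    show "(\<bar>c\<bar> * norm f)-lipschitz_on UNIV (lip0_apply (c *\<^sub>R f))"
      using lipschitz_on_cmult_real[OF lip, of c f] by (simp add: scaleR_lip0.rep_eq)
  qed
  show "f + g + h = f + (g + h)" "f + g = g + f" "0 + f = f" "- f + f = 0" "f - g = f + - g"
    by (transfer; auto)+
  show "c *\<^sub>R (f + g) = c *\<^sub>R f + c *\<^sub>R g" "(a + b) *\<^sub>R f = a *\<^sub>R f + b *\<^sub>R f"
    "a *\<^sub>R b *\<^sub>R f = (a * b) *\<^sub>R f" "1 *\<^sub>R f = f"
    by (transfer; auto simp: algebra_simps)+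
  show "dist f g = norm (f - g)" "sgn f = inverse (norm f) *\<^sub>R f"
    by (simp_all add: dist_lip0_def sgn_lip0_def)
  show "uniformity = (INF e\<in>{0<..}. principal {(f, g). dist (f :: 'a lip0) g < e})"
    by (rule uniformity_lip0_def)
  show "open U = (\<forall>f\<in>U. \<forall>\<^sub>F (f', g) in uniformity. f' = f \<longrightarrow> g \<in> U)" for U :: "'a lip0 set"
    by (rule open_lip0_def)
  show "norm (f + g) \<le> norm f + norm g"
    by (rule norm_le) (use lipschitz_on_add[OF lip lip, of f g] in \<open>simp add: plus_lip0.rep_eq\<close>)
  show "norm (c *\<^sub>R f) = \<bar>c\<bar> * norm f"
  proof (cases "c = 0")
    case True
    then show ?thesis using scale_le[of c f] nonneg[of "c *\<^sub>R f"] by simp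
  next
    case False
    have "inverse c *\<^sub>R c *\<^sub>R f = f"
      using False by transfer auto
    then have "norm f \<le> \<bar>inverse c\<bar> * norm (c *\<^sub>R f)"
      using scale_le[of "inverse c" "c *\<^sub>R f"] by simp
    then have "\<bar>c\<bar> * norm f \<le> norm (c *\<^sub>R f)"
      using False by (simp add: field_simps)
    with scale_le[of c f] show ?thesis by simp
  qed
  show "(norm f = 0) = (f = 0)"
  proof
    assume "norm f = 0"
    then have "dist (lip0_apply f x) (lip0_apply f 0) \<le> 0" for x
      using lipschitz_onD[OF lip, of x 0 f] by simp
    then have "lip0_apply f x = 0" for x
      by (metis dist_le_zero_iff lip0_apply_base)
    then show "f = 0"
      by (auto intro: lip0_eqI simp: zero_lip0.rep_eq)
  next
    assume "f = 0"
    then have "norm f \<le> 0"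
      by (auto intro!: norm_le lipschitz_on_constant simp: zero_lip0.rep_eq)
    with nonneg[of f] show "norm f = 0" by simp
  qed
qed

end

lemma lip0_lipschitz: "(norm f)-lipschitz_on UNIV (lip0_apply f)"
  by transfer (auto intro: best_lipschitz_lipschitz)

lemma norm_lip0_le: "C-lipschitz_on UNIV (lip0_apply f) \<Longrightarrow> norm f \<le> C"
  by transfer (auto intro: best_lipschitz_le)

lift_definition delta :: "'a::{metric_space, zero} \<Rightarrow> 'a lip0 \<Rightarrow>\<^sub>L real"
  is "\<lambda>x f. lip0_apply f x"
proof (rule bounded_linear_intro)
  fix x :: 'a and f g :: "'a lip0" and c :: real
  show "lip0_apply (f + g) x = lip0_apply f x + lip0_apply g x"
    by (simp add: plus_lip0.rep_eq)
  show "lip0_apply (c *\<^sub>R f) x = c *\<^sub>R lip0_apply f x"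
    by (simp add: scaleR_lip0.rep_eq)
  show "norm (lip0_apply f x) \<le> norm f * dist x 0"
    using lipschitz_onD[OF lip0_lipschitz, of x 0 f] by (simp add: dist_real_def)
qed

text \<open>
  \<open>free_space UNIV\<close> is the Lipschitz-free space over the whole type; for a subset \<open>N\<close>,
  \<open>free_space N\<close> is the free space over \<open>N\<close> as a closed subspace of it. The closure is taken
  in the operator norm topology of the dual of \<open>'a lip0\<close>.
\<close>

definition free_space :: "'a::{metric_space, zero} set \<Rightarrow> ('a lip0 \<Rightarrow>\<^sub>L real) set" where
  "free_space N = closure (span (delta ` N))"

typedef ell1 = "{x :: nat \<Rightarrow> real. summable (\<lambda>n. \<bar>x n\<bar>)}"
  morphisms ell1_apply Abs_ell1
  by (rule exI[of _ "\<lambda>_. 0"]) simp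

setup_lifting type_definition_ell1

lemma summable_abs_add:
  fixes x y :: "nat \<Rightarrow> real"
  assumes "summable (\<lambda>n. \<bar>x n\<bar>)" "summable (\<lambda>n. \<bar>y n\<bar>)"
  shows "summable (\<lambda>n. \<bar>x n + y n\<bar>)"
  using summable_add[OF assms] by (rule summable_comparison_test'[where N = 0]) auto

instantiation ell1 :: real_normed_vector
begin

lift_definition zero_ell1 :: ell1 is "\<lambda>_. 0"
  by simp

lift_definition plus_ell1 :: "ell1 \<Rightarrow> ell1 \<Rightarrow> ell1" is "\<lambda>x y n. x n + y n"
  by (rule summable_abs_add)

lift_definition uminus_ell1 :: "ell1 \<Rightarrow> ell1" is "\<lambda>x n. - x n"
  by simp

lift_definition minus_ell1 :: "ell1 \<Rightarrow> ell1 \<Rightarrow> ell1" is "\<lambda>x y n. x n - y n"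
proof -
  fix x y :: "nat \<Rightarrow> real"
  assume "summable (\<lambda>n. \<bar>x n\<bar>)" "summable (\<lambda>n. \<bar>y n\<bar>)"
  then show "summable (\<lambda>n. \<bar>x n - y n\<bar>)"
    using summable_abs_add[of x "\<lambda>n. - y n"] by simp
qed

lift_definition scaleR_ell1 :: "real \<Rightarrow> ell1 \<Rightarrow> ell1" is "\<lambda>c x n. c * x n"
  by (simp add: abs_mult summable_mult)

lift_definition norm_ell1 :: "ell1 \<Rightarrow> real" is "\<lambda>x. \<Sum>n. \<bar>x n\<bar>" .

definition dist_ell1 :: "ell1 \<Rightarrow> ell1 \<Rightarrow> real" where
  "dist_ell1 x y = norm (x - y)"

definition sgn_ell1 :: "ell1 \<Rightarrow> ell1" where
  "sgn_ell1 x = inverse (norm x) *\<^sub>R x"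

definition uniformity_ell1 :: "(ell1 \<times> ell1) filter" where
  "uniformity_ell1 = (INF e\<in>{0<..}. principal {(x, y). dist x y < e})"

definition open_ell1 :: "ell1 set \<Rightarrow> bool" where
  "open_ell1 U = (\<forall>x\<in>U. \<forall>\<^sub>F (x', y) in uniformity. x' = x \<longrightarrow> y \<in> U)"

instance
proof
  fix x y z :: ell1 and a b c :: real
  show "x + y + z = x + (y + z)" "x + y = y + x" "0 + x = x" "- x + x = 0" "x - y = x + - y"
    by (transfer; auto)+
  show "c *\<^sub>R (x + y) = c *\<^sub>R x + c *\<^sub>R y" "(a + b) *\<^sub>R x = a *\<^sub>R x + b *\<^sub>R x"
    "a *\<^sub>R b *\<^sub>R x = (a * b) *\<^sub>R x" "1 *\<^sub>R x = x"
    by (transfer; auto simp: algebra_simps)+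
  show "dist x y = norm (x - y)" "sgn x = inverse (norm x) *\<^sub>R x"
    by (simp_all add: dist_ell1_def sgn_ell1_def)
  show "uniformity = (INF e\<in>{0<..}. principal {(x, y). dist (x :: ell1) y < e})"
    by (rule uniformity_ell1_def)
  show "open U = (\<forall>x\<in>U. \<forall>\<^sub>F (x', y) in uniformity. x' = x \<longrightarrow> y \<in> U)" for U :: "ell1 set"
    by (rule open_ell1_def)
  show "norm (x + y) \<le> norm x + norm y"
  proof transfer
    fix x y :: "nat \<Rightarrow> real"
    assume *: "summable (\<lambda>n. \<bar>x n\<bar>)" "summable (\<lambda>n. \<bar>y n\<bar>)"
    have "summable (\<lambda>n. \<bar>x n + y n\<bar>)"
      using * by (rule summable_abs_add)
    then have "(\<Sum>n. \<bar>x n + y n\<bar>) \<le> (\<Sum>n. \<bar>x n\<bar> + \<bar>y n\<bar>)"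
      using * by (intro suminf_le summable_add) (auto intro: abs_triangle_ineq)
    also have "\<dots> = (\<Sum>n. \<bar>x n\<bar>) + (\<Sum>n. \<bar>y n\<bar>)"
      using * by (simp add: suminf_add)
    finally show "(\<Sum>n. \<bar>x n + y n\<bar>) \<le> (\<Sum>n. \<bar>x n\<bar>) + (\<Sum>n. \<bar>y n\<bar>)" .
  qed
  show "norm (c *\<^sub>R x) = \<bar>c\<bar> * norm x"
    by transfer (simp add: abs_mult suminf_mult)
  show "(norm x = 0) = (x = 0)"
    by transfer (auto simp: suminf_eq_zero_iff)
qed

end

definition linearly_homeomorphic ::
    "'a::real_normed_vector set \<Rightarrow> 'b::real_normed_vector set \<Rightarrow> bool" where
  "linearly_homeomorphic X Y \<longleftrightarrow>
    (\<exists>T S. homeomorphism X Y T S \<and>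
      (\<forall>x\<in>X. \<forall>y\<in>X. T (x + y) = T x + T y) \<and>
      (\<forall>c. \<forall>x\<in>X. T (c *\<^sub>R x) = c *\<^sub>R T x))"

definition isomorphic_to_subspace ::
    "'a::real_normed_vector set \<Rightarrow> 'b::real_normed_vector set \<Rightarrow> bool" where
  "isomorphic_to_subspace X Z \<longleftrightarrow>
    (\<exists>Y. subspace Y \<and> Y \<subseteq> Z \<and> linearly_homeomorphic X Y)"

end

theory Submission
  imports Defs
begin

text \<open>
  For a finite set \<open>E\<close> containing the base point consider the relative neighbourhood
  \<open>N(E,d) = {y. infdist y E \<le> d * dist y 0}\<close>. If \<open>X\<close> contains no copy of \<open>ell1\<close>, then for all
  \<open>d, e > 0\<close> some \<open>E\<close> satisfies \<open>\<bar>\<mu> f\<bar> \<le> e * norm \<mu> * norm f\<close> for all \<open>\<mu> \<in> X\<close> and all \<open>f\<close> vanishing on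
  \<open>N(E,d)\<close>: otherwise a gliding hump yields unit vectors of \<open>X\<close> and Lipschitz functions with disjoint
  supports that are almost biorthogonal to them by Rosenthal's lemma, which makes a subsequence
  equivalent to the \<open>ell1\<close> basis.

  Multiplication by a cutoff function that is \<open>1\<close> on \<open>N(E,d)\<close> and \<open>0\<close> off \<open>N(E,2d)\<close> is bounded on
  \<open>lip0\<close> by a constant depending on \<open>d\<close> only. Hence for \<open>d\<^sub>k \<rightarrow> 0\<close> one can choose \<open>e\<^sub>k\<close>, then \<open>E\<^sub>k\<close>, so
  that the adjoints of multiplication by \<open>h\<^sub>0 \<cdots> h\<^sub>k\<close> converge on \<open>X\<close> to an operator \<open>T\<close> with
  \<open>norm (T \<mu> - \<mu>) \<le> norm \<mu> / 2\<close>. The intersection \<open>K\<close> of the sets \<open>N(E\<^sub>k,2d\<^sub>k)\<close> is compact, \<open>T \<mu>\<close>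
  annihilates the functions vanishing on \<open>K\<close>, and the Hahn--Banach theorem puts it into
  \<open>free_space K\<close>.
\<close>

subsection \<open>Copies of \<open>ell1\<close>\<close>

text \<open>Rosenthal's lemma, by induction on a bound \<open>m * \<eta>\<close> for the
  off-diagonal row sums over an index set. Split that set into infinitely many infinite pieces. If
  no piece works, each piece contains a row whose sum inside the piece exceeds
  \<open>\<eta>\<close>; over the set of these rows the bound falls by
  \<open>\<eta>\<close>.\<close>

lemma rosenthal_matrix:
  fixes a :: "nat \<Rightarrow> nat \<Rightarrow> real"
  assumes nonneg: "\<And>n k. 0 \<le> a n k" and "0 < \<eta>"
    and bound: "\<And>n A. finite A \<Longrightarrow> (\<Sum>k\<in>A. a n k) \<le> D"
  obtains J where "infinite J" "\<And>n A. n \<in> J \<Longrightarrow> finite A \<Longrightarrow> A \<subseteq> J - {n} \<Longrightarrow> (\<Sum>k\<in>A. a n k) \<le> \<eta>"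
proof -
  have *: "\<exists>J. infinite J \<and> (\<forall>n\<in>J. \<forall>A. finite A \<longrightarrow> A \<subseteq> J - {n} \<longrightarrow> (\<Sum>k\<in>A. a n k) \<le> \<eta>)"
    if "infinite I" "\<forall>n\<in>I. \<forall>A. finite A \<longrightarrow> A \<subseteq> I - {n} \<longrightarrow> (\<Sum>k\<in>A. a n k) \<le> real m * \<eta>"
    for m I
    using that
  proof (induction m arbitrary: I)
    case 0
    then have "\<forall>n\<in>I. \<forall>A. finite A \<longrightarrow> A \<subseteq> I - {n} \<longrightarrow> (\<Sum>k\<in>A. a n k) \<le> \<eta>"
      using \<open>0 < \<eta>\<close> by (metis less_imp_le mult_zero_left of_nat_0 order_trans)
    then show ?case using "0.prems"(1) by blast
  next
    case (Suc m)
    \<comment> \<open>The pairing \<open>prod_encode\<close> cuts the enumeration of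
      \<open>I\<close> into infinitely many disjoint infinite pieces.\<close>
    define N where "N p = range (\<lambda>i. enumerate I (prod_encode (p, i)))" for p
    have inj: "inj (enumerate I)"
      using Suc.prems(1) by (simp add: strict_mono_enumerate strict_mono_imp_inj_on)
    have NI: "N p \<subseteq> I" for p
      unfolding N_def using Suc.prems(1) by (auto intro: enumerate_in_set)
    have infN: "infinite (N p)" for p
      unfolding N_def by (rule range_inj_infinite, rule injI) (use inj in \<open>auto dest!: injD\<close>)
    have disj: "p = q" if "x \<in> N p" "x \<in> N q" for x p q
      using that inj by (auto simp: N_def dest!: injD)
    show ?case
    proof (cases "\<exists>p. \<forall>n\<in>N p. \<forall>A. finite A \<longrightarrow> A \<subseteq> N p - {n} \<longrightarrow> (\<Sum>k\<in>A. a n k) \<le> \<eta>")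
      case True
      then show ?thesis using infN by blast
    next
      case False
      then have "\<forall>p. \<exists>n A. n \<in> N p \<and> finite A \<and> A \<subseteq> N p - {n} \<and> \<eta> < (\<Sum>k\<in>A. a n k)"
        by (meson not_le)
      then obtain n A where n: "\<And>p. n p \<in> N p" and A: "\<And>p. finite (A p)" "\<And>p. A p \<subseteq> N p - {n p}"
        and big: "\<And>p. \<eta> < (\<Sum>k\<in>A p. a (n p) k)" by metis
      have injn: "inj n"
        by (rule injI) (metis n disj)
      show ?thesis
      proof (rule Suc.IH[of "range n"])
        show "infinite (range n)"
          using injn by (rule range_inj_infinite)
        show "\<forall>x\<in>range n. \<forall>B. finite B \<longrightarrow> B \<subseteq> range n - {x} \<longrightarrow> (\<Sum>k\<in>B. a x k) \<le> real m * \<eta>"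
        proof (intro ballI allI impI)
          fix x B assume "x \<in> range n" and B: "finite B" "B \<subseteq> range n - {x}"
          then obtain p where p: "x = n p" by auto
          \<comment> \<open>\<open>range n\<close> meets the piece \<open>N p\<close> only in
            \<open>n p\<close>, which \<open>A p\<close> avoids.\<close>
          have "A p \<inter> B = {}"
            using A(2)[of p] B(2) n disj p by blast
          then have "(\<Sum>k\<in>A p. a x k) + (\<Sum>k\<in>B. a x k) = (\<Sum>k\<in>A p \<union> B. a x k)"
            using A B by (simp add: sum.union_disjoint)
          also have "\<dots> \<le> real (Suc m) * \<eta>"
          proof -
            have "A p \<union> B \<subseteq> I - {x}" "x \<in> I"
              using A(2)[of p] B(2) n NI p by blast+
            then show ?thesis
              using Suc.prems(2)[rule_format, of x "A p \<union> B"] A(1) B(1) by simp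
          qed
          finally show "(\<Sum>k\<in>B. a x k) \<le> real m * \<eta>"
            using big[of p] p by (simp add: algebra_simps)
        qed
      qed
    qed
  qed
  obtain m where "D / \<eta> \<le> real m"
    using real_arch_simple by blast
  then have "D \<le> real m * \<eta>"
    using \<open>0 < \<eta>\<close> by (simp add: divide_le_eq)
  then have "\<forall>n\<in>UNIV. \<forall>A. finite A \<longrightarrow> A \<subseteq> UNIV - {n} \<longrightarrow> (\<Sum>k\<in>A. a n k) \<le> real m * \<eta>"
    using bound order_trans by blast
  from *[OF infinite_UNIV_nat this] obtain J where "infinite J"
    and J: "\<forall>n\<in>J. \<forall>A. finite A \<longrightarrow> A \<subseteq> J - {n} \<longrightarrow> (\<Sum>k\<in>A. a n k) \<le> \<eta>"
    by blast
  show thesis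
    by (rule that[OF \<open>infinite J\<close>]) (rule J[rule_format])
qed

text \<open>The two norm estimates make the map and its inverse Lipschitz. Linearity is stated on
  \<open>S\<close> alone because one of the maps treated this way is a limit known to exist only
  there.\<close>

lemma linear_embedding_image:
  fixes T :: "'a::real_normed_vector \<Rightarrow> 'b::real_normed_vector"
  assumes S: "subspace S" and "T ` S \<subseteq> Z"
    and add: "\<And>x y. x \<in> S \<Longrightarrow> y \<in> S \<Longrightarrow> T (x + y) = T x + T y"
    and scale: "\<And>c x. x \<in> S \<Longrightarrow> T (c *\<^sub>R x) = c *\<^sub>R T x"
    and lower: "\<And>x. x \<in> S \<Longrightarrow> m * norm x \<le> norm (T x)" and "0 < m"
    and upper: "\<And>x. x \<in> S \<Longrightarrow> norm (T x) \<le> B * norm x"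
  shows "isomorphic_to_subspace S Z"
proof -
  have diff: "T x - T y = T (x - y)" if "x \<in> S" "y \<in> S" for x y
    using add[of "x - y" y] that subspace_diff[OF S] by simp
  have inj: "inj_on T S"
  proof (rule inj_onI)
    fix x y assume "x \<in> S" "y \<in> S" "T x = T y"
    then have "m * norm (x - y) \<le> 0"
      using lower[of "x - y"] diff[of x y] subspace_diff[OF S] by simp
    then show "x = y"
      using \<open>0 < m\<close> by (simp add: mult_le_0_iff)
  qed
  have "(\<bar>B\<bar>)-lipschitz_on S T"
  proof (rule lipschitz_onI)
    fix x y assume "x \<in> S" "y \<in> S"
    then show "dist (T x) (T y) \<le> \<bar>B\<bar> * dist x y"
      using upper[OF subspace_diff[OF S, of x y]] mult_right_mono[of B "\<bar>B\<bar>" "norm (x - y)"]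
      by (simp add: dist_norm diff) linarith
  qed simp
  moreover have "(1/m)-lipschitz_on (T ` S) (inv_into S T)"
  proof (rule lipschitz_onI)
    fix u v assume "u \<in> T ` S" "v \<in> T ` S"
    then obtain x y where "x \<in> S" "y \<in> S" "u = T x" "v = T y" by auto
    then show "dist (inv_into S T u) (inv_into S T v) \<le> 1/m * dist u v"
      using lower[of "x - y"] subspace_diff[OF S] \<open>0 < m\<close> inj
      by (simp add: dist_norm diff field_simps)
  qed (use \<open>0 < m\<close> in simp)
  ultimately have "homeomorphism S (T ` S) T (inv_into S T)"
    using inj by (intro homeomorphismI) (auto intro: lipschitz_on_continuous_on inv_into_into)
  moreover have "subspace (T ` S)"
    unfolding subspace_def
  proof (intro conjI ballI allI)
    show "0 \<in> T ` S"
      using scale[of 0 0] subspace_0[OF S] by force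
    fix u v assume "u \<in> T ` S" "v \<in> T ` S"
    then show "u + v \<in> T ` S"
      using add subspace_add[OF S] by (metis (no_types, lifting) imageE imageI)
  next
    fix c u assume "u \<in> T ` S"
    then show "c *\<^sub>R u \<in> T ` S"
      using scale subspace_scale[OF S] by (metis (no_types, lifting) imageE imageI)
  qed
  ultimately show ?thesis
    unfolding isomorphic_to_subspace_def linearly_homeomorphic_def
    using add scale \<open>T ` S \<subseteq> Z\<close> by blast
qed

text \<open>The embedding sends \<open>x\<close> to the absolutely convergent series of
  \<open>ell1_apply x n *\<^sub>R v n\<close>. Its sum stays in \<open>X\<close> because
  \<open>X\<close> is closed, and the lower estimate passes from partial sums to the limit.\<close>

lemma ell1_embeds:
  fixes v :: "nat \<Rightarrow> 'b::banach"
  assumes X: "subspace X" "closed X"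
    and v: "\<And>n. v n \<in> X" "\<And>n. norm (v n) \<le> 1" and "0 < c"
    and lower: "\<And>a N. c * (\<Sum>n<N. \<bar>a n\<bar>) \<le> norm (\<Sum>n<N. a n *\<^sub>R v n)"
  shows "isomorphic_to_subspace (UNIV :: ell1 set) X"
proof -
  have abs: "summable (\<lambda>n. \<bar>ell1_apply x n\<bar>)" for x
    using ell1_apply[of x] by simp
  have le: "norm (ell1_apply x n *\<^sub>R v n) \<le> \<bar>ell1_apply x n\<bar>" for x n
    using mult_left_mono[OF v(2), of "\<bar>ell1_apply x n\<bar>"] by simp
  have sm: "summable (\<lambda>n. norm (ell1_apply x n *\<^sub>R v n))" for x
    by (rule summable_comparison_test'[OF abs, where N = 0]) (use le in auto)
  note sm' = summable_norm_cancel[OF sm]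
  define J where "J x = (\<Sum>n. ell1_apply x n *\<^sub>R v n)" for x
  show ?thesis
  proof (rule linear_embedding_image[where T = J and m = c and B = 1])
    show "J (x + y) = J x + J y" for x y
      unfolding J_def by (simp add: suminf_add[OF sm' sm'] plus_ell1.rep_eq scaleR_add_left)
    show "J (b *\<^sub>R x) = b *\<^sub>R J x" for b x
      unfolding J_def by (simp add: suminf_scaleR_right[OF sm'] scaleR_ell1.rep_eq)
    show "J ` UNIV \<subseteq> X"
    proof clarify
      fix x
      have "(\<Sum>n<N. ell1_apply x n *\<^sub>R v n) \<in> X" for N
        using X v by (intro subspace_sum subspace_scale) auto
      moreover have "(\<lambda>N. \<Sum>n<N. ell1_apply x n *\<^sub>R v n) \<longlonglongrightarrow> J x"
        unfolding J_def by (rule summable_LIMSEQ[OF sm'])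
      ultimately show "J x \<in> X"
        by (rule closed_sequentially[OF X(2)])
    qed
    show "c * norm x \<le> norm (J x)" for x
    proof (rule LIMSEQ_le)
      show "(\<lambda>N. c * (\<Sum>n<N. \<bar>ell1_apply x n\<bar>)) \<longlonglongrightarrow> c * norm x"
        unfolding norm_ell1.rep_eq by (intro tendsto_intros summable_LIMSEQ[OF abs])
      show "(\<lambda>N. norm (\<Sum>n<N. ell1_apply x n *\<^sub>R v n)) \<longlonglongrightarrow> norm (J x)"
        unfolding J_def by (intro tendsto_intros summable_LIMSEQ[OF sm'])
    qed (use lower in auto)
    have "norm (J x) \<le> norm x" for x
      unfolding J_def norm_ell1.rep_eq
      using summable_norm[OF sm, of x] suminf_le[OF le sm abs, of x] by linarith
    then show "norm (J x) \<le> 1 * norm x" for x by simp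
  qed (use \<open>0 < c\<close> in \<open>auto\<close>)
qed

text \<open>Testing against signed sums of the \<open>g k\<close> bounds all row sums by
  \<open>D\<close>, so Rosenthal's lemma gives a subsequence with off-diagonal sums at most
  \<open>e/2\<close>, against a diagonal of at least \<open>e\<close>. A suitably signed sum of the
  \<open>g k\<close>, of norm at most \<open>D\<close>, then detects a combination of the
  functionals with constant \<open>e/(2*D)\<close>.\<close>

lemma almost_biorthogonal_imp_ell1:
  fixes \<mu> :: "nat \<Rightarrow> ('b::real_normed_vector \<Rightarrow>\<^sub>L real)" and g :: "nat \<Rightarrow> 'b"
  assumes X: "subspace X" "closed X" and \<mu>: "\<And>n. \<mu> n \<in> X" "\<And>n. norm (\<mu> n) \<le> 1"
    and "0 < e" and diag: "\<And>n. e \<le> \<bar>blinfun_apply (\<mu> n) (g n)\<bar>"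
    and bound: "\<And>A \<theta>. finite A \<Longrightarrow> (\<And>k. \<bar>\<theta> k\<bar> \<le> 1) \<Longrightarrow> norm (\<Sum>k\<in>A. \<theta> k *\<^sub>R g k) \<le> D"
  shows "isomorphic_to_subspace (UNIV :: ell1 set) X"
proof -
  have D0: "0 < D"
  proof -
    have "0 < norm (g 0)"
      using diag[of 0] \<open>0 < e\<close> by (cases "g 0 = 0") (auto simp: blinfun.zero_right)
    moreover have "norm (g 0) \<le> D"
      using bound[of "{0}" "\<lambda>_. 1"] by simp
    ultimately show ?thesis by linarith
  qed
  have sum: "(\<Sum>k\<in>A. \<bar>blinfun_apply (\<mu> n) (g k)\<bar>) \<le> D" if "finite A" for n A
  proof -
    have "(\<Sum>k\<in>A. \<bar>blinfun_apply (\<mu> n) (g k)\<bar>)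
        = blinfun_apply (\<mu> n) (\<Sum>k\<in>A. sgn (blinfun_apply (\<mu> n) (g k)) *\<^sub>R g k)"
      by (simp add: blinfun.sum_right blinfun.scaleR_right abs_sgn mult.commute)
    also have "\<dots> \<le> norm (\<mu> n) * norm (\<Sum>k\<in>A. sgn (blinfun_apply (\<mu> n) (g k)) *\<^sub>R g k)"
      using norm_blinfun abs_le_D1 real_norm_def by metis
    also have "\<dots> \<le> 1 * D"
      by (rule mult_mono[OF \<mu>(2) bound[OF that]]) (auto simp: sgn_if)
    finally show ?thesis by simp
  qed
  obtain J where J: "infinite J" and off: "\<And>n A. n \<in> J \<Longrightarrow> finite A \<Longrightarrow> A \<subseteq> J - {n} \<Longrightarrow>
      (\<Sum>k\<in>A. \<bar>blinfun_apply (\<mu> n) (g k)\<bar>) \<le> e/2"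
    using rosenthal_matrix[of "\<lambda>n k. \<bar>blinfun_apply (\<mu> n) (g k)\<bar>" "e/2" D] sum \<open>0 < e\<close> by auto
  define s where "s = enumerate J"
  have s: "s n \<in> J" for n
    unfolding s_def using J by (rule enumerate_in_set)
  have injs: "inj s"
    unfolding s_def using J by (simp add: strict_mono_enumerate strict_mono_imp_inj_on)
  show ?thesis
  proof (rule ell1_embeds[where v = "\<lambda>n. \<mu> (s n)" and c = "e/(2*D)"])
    fix a :: "nat \<Rightarrow> real" and N
    \<comment> \<open>With these signs the diagonal contributions are products of absolute values,
      so nothing cancels.\<close>
    define \<sigma> where "\<sigma> n = sgn (a n) * sgn (blinfun_apply (\<mu> (s n)) (g (s n)))" for n
    define G where "G = (\<Sum>k<N. \<sigma> k *\<^sub>R g (s k))"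
    have \<sigma>: "\<bar>\<sigma> k\<bar> \<le> 1" for k
      unfolding \<sigma>_def by (auto simp: abs_mult sgn_if)
    have G: "norm G \<le> D"
    proof -
      \<comment> \<open>\<open>bound\<close> speaks of the original indices, so the signs are
        transported along the inverse of \<open>s\<close>.\<close>
      have "G = (\<Sum>k\<in>s ` {..<N}. \<sigma> (inv s k) *\<^sub>R g k)"
        unfolding G_def using injs by (subst sum.reindex) (auto intro: inj_on_subset)
      then show ?thesis using bound[of "s ` {..<N}" "\<lambda>k. \<sigma> (inv s k)"] \<sigma> by simp
    qed
    have summand: "\<bar>a n\<bar> * (e/2) \<le> a n * blinfun_apply (\<mu> (s n)) G" if "n < N" for n
    proof -
      let ?m = "blinfun_apply (\<mu> (s n))"
      have split: "?m G = \<sigma> n * ?m (g (s n)) + (\<Sum>k\<in>{..<N}-{n}. \<sigma> k * ?m (g (s k)))"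
        unfolding G_def blinfun.sum_right blinfun.scaleR_right using that
        by (subst sum.remove[of _ n]) auto
      have "\<bar>\<Sum>k\<in>{..<N}-{n}. \<sigma> k * ?m (g (s k))\<bar> \<le> (\<Sum>k\<in>{..<N}-{n}. \<bar>\<sigma> k * ?m (g (s k))\<bar>)"
        by (rule sum_abs)
      also have "\<dots> \<le> (\<Sum>k\<in>{..<N}-{n}. \<bar>?m (g (s k))\<bar>)"
        using \<sigma> by (intro sum_mono) (simp add: abs_mult mult_left_le_one_le)
      also have "\<dots> = (\<Sum>k\<in>s ` ({..<N}-{n}). \<bar>?m (g k)\<bar>)"
        using injs by (subst sum.reindex) (auto intro: inj_on_subset)
      also have "\<dots> \<le> e/2"
        using injs s by (intro off) (auto simp: inj_eq)
      finally have rest: "\<bar>\<Sum>k\<in>{..<N}-{n}. \<sigma> k * ?m (g (s k))\<bar> \<le> e/2" .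
      have "a n * (\<sigma> n * ?m (g (s n))) = \<bar>a n\<bar> * \<bar>?m (g (s n))\<bar>"
        unfolding \<sigma>_def by (auto simp: sgn_if abs_if)
      moreover have "\<bar>a n\<bar> * e \<le> \<bar>a n\<bar> * \<bar>?m (g (s n))\<bar>"
        using diag by (intro mult_left_mono) auto
      moreover
      have "\<bar>a n * (\<Sum>k\<in>{..<N}-{n}. \<sigma> k * ?m (g (s k)))\<bar> \<le> \<bar>a n\<bar> * (e/2)"
        unfolding abs_mult using rest by (intro mult_left_mono) auto
      then have "- (a n * (\<Sum>k\<in>{..<N}-{n}. \<sigma> k * ?m (g (s k)))) \<le> \<bar>a n\<bar> * (e/2)"
        by (rule abs_le_D2)
      ultimately show ?thesis
        unfolding split distrib_left by linarith
    qed
    have "(e/2) * (\<Sum>n<N. \<bar>a n\<bar>) \<le> (\<Sum>n<N. a n * blinfun_apply (\<mu> (s n)) G)"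
      unfolding sum_distrib_left using summand by (intro sum_mono) (auto simp: mult.commute)
    also have "\<dots> = blinfun_apply (\<Sum>n<N. a n *\<^sub>R \<mu> (s n)) G"
      by (simp add: blinfun.sum_left blinfun.scaleR_left)
    also have "\<dots> \<le> norm (\<Sum>n<N. a n *\<^sub>R \<mu> (s n)) * norm G"
      using norm_blinfun abs_le_D1 real_norm_def by metis
    also have "\<dots> \<le> norm (\<Sum>n<N. a n *\<^sub>R \<mu> (s n)) * D"
      using G by (rule mult_left_mono) simp
    finally show "e/(2*D) * (\<Sum>n<N. \<bar>a n\<bar>) \<le> norm (\<Sum>n<N. a n *\<^sub>R \<mu> (s n))"
      using D0 by (simp add: field_simps)
  qed (use X \<mu> \<open>0 < e\<close> D0 in auto)
qed

subsection \<open>Separation from a subspace\<close>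

definition sublinear :: "('a::real_vector \<Rightarrow> real) \<Rightarrow> bool" where
  "sublinear p \<longleftrightarrow> (\<forall>x y. p (x + y) \<le> p x + p y) \<and> (\<forall>c x. 0 < c \<longrightarrow> p (c *\<^sub>R x) = c * p x)"

lemma sublinear_add: "sublinear p \<Longrightarrow> p (x + y) \<le> p x + p y"
  and sublinear_scale: "sublinear p \<Longrightarrow> 0 < c \<Longrightarrow> p (c *\<^sub>R x) = c * p x"
  unfolding sublinear_def by auto

lemma sublinear_0: "sublinear p \<Longrightarrow> p 0 = 0"
  using sublinear_scale[of p 2 0] by simp

lemma sublinear_scale_nonneg: "sublinear p \<Longrightarrow> 0 \<le> c \<Longrightarrow> p (c *\<^sub>R x) = c * p x"
  by (cases "c = 0") (auto simp: sublinear_0 sublinear_scale)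

lemma sublinear_lower: "sublinear p \<Longrightarrow> - p (- x) \<le> p x"
  using sublinear_add[of p x "- x"] sublinear_0[of p] by simp

text \<open>Lowering \<open>p\<close> along the ray through \<open>v\<close>; a minimal sublinear functional is not changed by
  this, which forces it to be additive.\<close>
lemma sublinear_lowering:
  fixes v :: "'a::real_vector"
  assumes p: "sublinear p"
  defines "q \<equiv> \<lambda>x. INF t\<in>{0..}. p (x + t *\<^sub>R v) - t * p v"
  shows "sublinear q" "q x \<le> p x" "q (- v) \<le> - p v" "q x \<le> p (x + v) - p v"
proof -
  \<comment> \<open>Subadditivity bounds the values from below, so the infimum defining
    \<open>q\<close> is a genuine one.\<close>
  have bdd: "bdd_below ((\<lambda>t. p (x + t *\<^sub>R v) - t * p v) ` {0..})" for x
  proof (rule bdd_belowI2[of _ "- p (- x)"])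
    fix t :: real assume "t \<in> {0..}"
    then have "t * p v = p ((x + t *\<^sub>R v) + (- x))"
      using sublinear_scale_nonneg[OF p, of t v] by simp
    also have "\<dots> \<le> p (x + t *\<^sub>R v) + p (- x)"
      by (rule sublinear_add[OF p])
    finally show "- p (- x) \<le> p (x + t *\<^sub>R v) - t * p v" by simp
  qed
  have le: "q x \<le> p (x + t *\<^sub>R v) - t * p v" if "0 \<le> t" for x t
    unfolding q_def by (rule cINF_lower[OF bdd]) (use that in simp)
  have ge: "c \<le> q x" if "\<And>t. 0 \<le> t \<Longrightarrow> c \<le> p (x + t *\<^sub>R v) - t * p v" for c x
    unfolding q_def by (rule cINF_greatest) (use that in auto)
  show "q x \<le> p x" "q (- v) \<le> - p v" "q x \<le> p (x + v) - p v"
    using le[of 0 x] le[of 1 "- v"] le[of 1 x] sublinear_0[OF p] by auto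
  have scale: "c * q x \<le> q (c *\<^sub>R x)" if "0 < c" for c x
  proof (rule ge)
    fix t :: real assume "0 \<le> t"
    have "c * q x \<le> c * (p (x + (t/c) *\<^sub>R v) - (t/c) * p v)"
      using le[of "t/c" x] \<open>0 \<le> t\<close> that by (intro mult_left_mono) auto
    also have "\<dots> = p (c *\<^sub>R (x + (t/c) *\<^sub>R v)) - t * p v"
      using that by (simp add: sublinear_scale[OF p that] right_diff_distrib)
    finally show "c * q x \<le> p (c *\<^sub>R x + t *\<^sub>R v) - t * p v"
      using that by (simp add: scaleR_add_right)
  qed
  have "q (c *\<^sub>R x) \<le> c * q x" if "0 < c" for c x
    using scale[of "inverse c" "c *\<^sub>R x"] that by (simp add: field_simps)
  with scale have "q (c *\<^sub>R x) = c * q x" if "0 < c" for c x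
    using that by (meson order_antisym)
  moreover have "q (x + y) \<le> q x + q y" for x y
  proof -
    \<comment> \<open>The parameters \<open>s\<close> and \<open>t\<close> of the two infima add up
      to a parameter for \<open>x + y\<close>; the infima are then taken one after the
      other.\<close>
    have "q (x + y) - (p (y + t *\<^sub>R v) - t * p v) \<le> q x" if "0 \<le> t" for t
    proof (rule ge)
      fix s :: real assume "0 \<le> s"
      then have "q (x + y) \<le> p ((x + y) + (s + t) *\<^sub>R v) - (s + t) * p v"
        using that by (intro le) simp
      also have "(x + y) + (s + t) *\<^sub>R v = (x + s *\<^sub>R v) + (y + t *\<^sub>R v)"
        by (simp add: scaleR_add_left)
      also have "p \<dots> \<le> p (x + s *\<^sub>R v) + p (y + t *\<^sub>R v)"
        by (rule sublinear_add[OF p])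
      finally show "q (x + y) - (p (y + t *\<^sub>R v) - t * p v) \<le> p (x + s *\<^sub>R v) - s * p v"
        by (simp add: algebra_simps)
    qed
    then have "q (x + y) - q x \<le> q y"
      by (intro ge) (simp add: algebra_simps)
    then show ?thesis by simp
  qed
  ultimately show "sublinear q"
    unfolding sublinear_def by blast
qed

text \<open>Zorn's lemma gives a minimal sublinear functional below \<open>p\<close>. Lowering it
  along any \<open>y\<close> changes nothing, and the last inequality of the lowering lemma becomes
  superadditivity.\<close>

lemma sublinear_dominates_linear:
  fixes p :: "'a::real_vector \<Rightarrow> real"
  assumes "sublinear p"
  obtains \<phi> where "linear \<phi>" "\<And>x. \<phi> x \<le> p x"
proof -
  define A where "A = {q. sublinear q \<and> (\<forall>x. q x \<le> p x)}"
  \<comment> \<open>The pointwise order is reversed, so that a maximal element for Zorn's lemma is a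
    minimal functional.\<close>
  define P where "P q r \<longleftrightarrow> (\<forall>x. r x \<le> q x)" for q r :: "'a \<Rightarrow> real"
  have "\<exists>m\<in>A. \<forall>a\<in>A. P m a \<longrightarrow> a = m"
  proof (rule predicate_Zorn)
    show "partial_order_on A (relation_of P A)"
      by (rule partial_order_on_relation_ofI) (auto simp: P_def fun_eq_iff intro: order_trans order_antisym)
    fix C assume C: "C \<in> Chains (relation_of P A)"
    then have CA: "C \<subseteq> A"
      unfolding Chains_def relation_of_def by blast
    have chain: "P q r \<or> P r q" if "q \<in> C" "r \<in> C" for q r
      using that C unfolding Chains_def relation_of_def by blast
    show "\<exists>u\<in>A. \<forall>a\<in>C. P a u"
    proof (cases "C = {}")
      case True
      then show ?thesis using assms by (auto simp: A_def)
    next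
      case False
      define u where "u x = (INF q\<in>C. q x)" for x
      have bdd: "bdd_below ((\<lambda>q. q x) ` C)" for x
      proof (rule bdd_belowI2[of _ "- p (- x)"])
        fix q assume "q \<in> C"
        then have "- q (- x) \<le> q x" "q (- x) \<le> p (- x)"
          using CA sublinear_lower by (auto simp: A_def)
        then show "- p (- x) \<le> q x" by linarith
      qed
      have le: "u x \<le> q x" if "q \<in> C" for q x
        unfolding u_def by (rule cINF_lower[OF bdd that])
      have ge: "c \<le> u x" if "\<And>q. q \<in> C \<Longrightarrow> c \<le> q x" for c x
        unfolding u_def by (rule cINF_greatest[OF False that])
      have add: "u (x + y) \<le> u x + u y" for x y
      proof -
        have "u (x + y) \<le> q x + r y" if qr: "q \<in> C" "r \<in> C" for q r
        proof -
          \<comment> \<open>Since \<open>q\<close> and \<open>r\<close> are comparable, the smaller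
            one serves at both points.\<close>
          obtain s where s: "s \<in> C" "s x \<le> q x" "s y \<le> r y"
            using chain[OF qr] qr unfolding P_def by blast
          then have "u (x + y) \<le> s x + s y"
            using le[of s "x + y"] sublinear_add[of s x y] CA by (auto simp: A_def)
          with s show ?thesis by linarith
        qed
        then have "u (x + y) - r y \<le> u x" if "r \<in> C" for r
          using that by (intro ge) (simp add: algebra_simps)
        then have "u (x + y) - u x \<le> u y"
          by (intro ge) (simp add: algebra_simps)
        then show ?thesis by simp
      qed
      have scale: "c * u x \<le> u (c *\<^sub>R x)" if "0 < c" for c x
      proof (rule ge)
        fix q assume "q \<in> C"
        then show "c * u x \<le> q (c *\<^sub>R x)"
          using le[of q x] that CA by (auto simp: A_def sublinear_scale)
      qed
      have "u (c *\<^sub>R x) \<le> c * u x" if "0 < c" for c x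
        using scale[of "inverse c" "c *\<^sub>R x"] that by (simp add: field_simps)
      with scale have "u (c *\<^sub>R x) = c * u x" if "0 < c" for c x
        using that by (meson order_antisym)
      with add have "sublinear u"
        unfolding sublinear_def by blast
      moreover have "u x \<le> p x" for x
        using False CA le order_trans unfolding A_def by blast
      ultimately show ?thesis
        using le unfolding A_def P_def by blast
    qed
  qed
  then obtain \<phi> where "\<phi> \<in> A" and min_A: "\<forall>q\<in>A. P \<phi> q \<longrightarrow> q = \<phi>"
    by blast
  then have \<phi>: "sublinear \<phi>" "\<And>x. \<phi> x \<le> p x"
    by (auto simp: A_def)
  have min: "q = \<phi>" if "sublinear q" "\<And>x. q x \<le> \<phi> x" for q
    using min_A that order_trans[OF that(2) \<phi>(2)] by (auto simp: A_def P_def)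
  have add: "\<phi> (x + y) = \<phi> x + \<phi> y" for x y
  proof (rule order_antisym)
    have "(\<lambda>x. INF t\<in>{0..}. \<phi> (x + t *\<^sub>R y) - t * \<phi> y) = \<phi>"
      using sublinear_lowering(1,2)[OF \<phi>(1)] by (intro min) auto
    then show "\<phi> x + \<phi> y \<le> \<phi> (x + y)"
      using sublinear_lowering(4)[OF \<phi>(1), where x = x and v = y] by (simp add: fun_eq_iff)
  qed (rule sublinear_add[OF \<phi>(1)])
  have minus: "\<phi> (- x) = - \<phi> x" for x
    using add[of x "- x"] sublinear_0[OF \<phi>(1)] by simp
  have "\<phi> (c *\<^sub>R x) = c * \<phi> x" for c x
  proof (cases "0 \<le> c")
    case False
    then show ?thesis
      using sublinear_scale[OF \<phi>(1), of "- c" x] minus[of "c *\<^sub>R x"] by simp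
  qed (rule sublinear_scale_nonneg[OF \<phi>(1)])
  then have "linear \<phi>"
    by (intro linearI add) simp
  then show thesis using \<phi>(2) that by blast
qed

text \<open>The distance to \<open>G\<close> is sublinear, at most the norm, zero on
  \<open>G\<close> and positive at \<open>x0\<close>. Lowering it along \<open>x0\<close> before
  taking a linear minorant forces the minorant to be at least this distance at
  \<open>x0\<close>.\<close>

lemma subspace_separation:
  fixes G :: "'a::real_normed_vector set"
  assumes G: "subspace G" and "x0 \<notin> closure G"
  obtains \<phi> where "linear \<phi>" "\<And>x. \<bar>\<phi> x\<bar> \<le> norm x" "\<And>x. x \<in> G \<Longrightarrow> \<phi> x = 0" "\<phi> x0 \<noteq> (0::real)"
proof -
  have ne: "G \<noteq> {}" using subspace_0[OF G] by auto
  define p where "p x = infdist x G" for x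
  have p_le: "p x \<le> norm (x - g)" if "g \<in> G" for x g
    unfolding p_def using infdist_le[OF that] by (simp add: dist_norm)
  have p_less: "\<exists>g\<in>G. norm (x - g) < c" if "p x < c" for x c
    using that ne cINF_less_iff[OF ne bdd_belowI2[of G 0 "dist x"], of c]
    unfolding p_def infdist_def by (simp add: dist_norm)
  have add: "p (x + y) \<le> p x + p y" for x y
  proof (rule field_le_epsilon)
    fix e :: real assume "0 < e"
    then obtain g h where gh: "g \<in> G" "norm (x - g) < p x + e/2" "h \<in> G" "norm (y - h) < p y + e/2"
      using p_less[of x "p x + e/2"] p_less[of y "p y + e/2"] by auto
    have "p (x + y) \<le> norm ((x + y) - (g + h))"
      using gh subspace_add[OF G] by (intro p_le) auto
    also have "\<dots> \<le> norm (x - g) + norm (y - h)"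
      using norm_triangle_ineq[of "x - g" "y - h"] by (simp add: algebra_simps)
    finally show "p (x + y) \<le> p x + p y + e"
      using gh by linarith
  qed
  have scale: "p (c *\<^sub>R x) \<le> c * p x" if "0 < c" for c x
  proof (rule field_le_epsilon)
    fix e :: real assume "0 < e"
    then obtain g where g: "g \<in> G" "norm (x - g) < p x + e/c"
      using p_less[of x "p x + e/c"] divide_pos_pos[OF \<open>0 < e\<close> \<open>0 < c\<close>] by auto
    have "p (c *\<^sub>R x) \<le> norm (c *\<^sub>R x - c *\<^sub>R g)"
      using g subspace_scale[OF G] by (intro p_le) auto
    also have "\<dots> = c * norm (x - g)"
      using that by (simp flip: scaleR_diff_right)
    also have "\<dots> \<le> c * (p x + e/c)"
      using g that by (intro mult_left_mono) auto
    finally show "p (c *\<^sub>R x) \<le> c * p x + e"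
      using that by (simp add: distrib_left)
  qed
  have "c * p x \<le> p (c *\<^sub>R x)" if "0 < c" for c x
    using scale[of "inverse c" "c *\<^sub>R x"] that by (simp add: field_simps)
  with scale have "p (c *\<^sub>R x) = c * p x" if "0 < c" for c x
    using that by (meson order_antisym)
  with add have p: "sublinear p"
    unfolding sublinear_def by blast
  let ?q = "\<lambda>x. INF t\<in>{0..}. p (x + t *\<^sub>R x0) - t * p x0"
  obtain \<phi> where lin: "linear \<phi>" and "\<And>x. \<phi> x \<le> ?q x"
    using sublinear_dominates_linear[OF sublinear_lowering(1)[OF p, of x0]] by blast
  then have le: "\<phi> x \<le> p x" and x0: "\<phi> (- x0) \<le> - p x0" for x
    using sublinear_lowering(2,3)[OF p, where v = x0] order_trans by blast+
  have neg: "\<phi> (- x) = - \<phi> x" for x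
    using lin by (rule linear_neg)
  show thesis
  proof (rule that[OF lin])
    show "\<bar>\<phi> x\<bar> \<le> norm x" for x
      using le[of x] le[of "- x"] p_le[OF subspace_0[OF G], of x] p_le[OF subspace_0[OF G], of "- x"]
      by (simp add: neg)
    show "\<phi> x = 0" if "x \<in> G" for x
      using le[of x] le[of "- x"] p_le[OF that, of x] p_le[OF subspace_neg[OF G that], of "- x"]
      by (simp add: neg)
    have "0 < p x0"
      unfolding p_def using assms(2) in_closure_iff_infdist_zero[OF ne, of x0] infdist_nonneg[of x0 G] by linarith
    then show "\<phi> x0 \<noteq> 0"
      using x0 by (simp add: neg)
  qed
qed

subsection \<open>Lipschitz-free spaces\<close>

lemma lip0_apply_le: "\<bar>lip0_apply f x\<bar> \<le> norm f * dist x 0"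
  using lipschitz_onD[OF lip0_lipschitz, of x 0 f] by (simp add: dist_real_def)

lemma lip0_apply_sum: "lip0_apply (\<Sum>k\<in>A. F k) x = (\<Sum>k\<in>A. lip0_apply (F k) x)"
  by (induction A rule: infinite_finite_induct) (auto simp: plus_lip0.rep_eq zero_lip0.rep_eq)

lemma delta_base [simp]: "delta 0 = 0"
  by (rule blinfun_eqI) (simp add: delta.rep_eq)

lemma closed_free_space: "closed (free_space N)"
  unfolding free_space_def by simp

lemma free_space_approx:
  assumes "\<mu> \<in> free_space N" "0 < e"
  obtains F \<nu> where "finite F" "F \<subseteq> N" "\<nu> \<in> span (delta ` F)" "norm (\<mu> - \<nu>) < e"
proof -
  obtain \<nu> where \<nu>: "\<nu> \<in> span (delta ` N)" "norm (\<mu> - \<nu>) < e"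
    using assms closure_approachable[of \<mu> "span (delta ` N)"]
    by (auto simp: free_space_def dist_norm norm_minus_commute)
  obtain t r where t: "finite t" "t \<subseteq> delta ` N" "\<nu> = (\<Sum>a\<in>t. r a *\<^sub>R a)"
    using \<nu>(1) unfolding span_explicit by blast
  then obtain F where "F \<subseteq> N" "finite F" "t = delta ` F"
    by (meson finite_subset_image)
  moreover have "\<nu> \<in> span t"
    unfolding t(3) by (intro span_sum span_scale span_base)
  ultimately show thesis
    using that \<nu>(2) by blast
qed

text \<open>Lets a function be replaced by its cutoff without changing the value of an approximating
  finite combination.\<close>

lemma span_delta_cong:
  assumes "\<nu> \<in> span (delta ` F)" "\<And>x. x \<in> F \<Longrightarrow> lip0_apply f x = lip0_apply g x"
  shows "blinfun_apply \<nu> f = blinfun_apply \<nu> g"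
  using assms(1)
  by (induction rule: span_induct_alt)
    (auto simp: blinfun.zero_left blinfun.add_left blinfun.scaleR_left delta.rep_eq assms(2))

text \<open>The distance of \<open>\<mu>\<close> to \<open>free_space K\<close> is detected by a functional \<open>\<phi>\<close> on the dual of
  \<open>lip0\<close>; the Lipschitz function \<open>x \<mapsto> \<phi> (delta x)\<close> represents it on the free space.\<close>
lemma free_space_memI:
  fixes \<mu> :: "'a::{metric_space, zero} lip0 \<Rightarrow>\<^sub>L real"
  assumes \<mu>: "\<mu> \<in> free_space UNIV"
    and ann: "\<And>f. (\<And>x. x \<in> K \<Longrightarrow> lip0_apply f x = 0) \<Longrightarrow> blinfun_apply \<mu> f = 0"
  shows "\<mu> \<in> free_space K"
proof (rule ccontr)
  assume "\<mu> \<notin> free_space K"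
  then obtain \<phi> :: "_ \<Rightarrow> real" where lin: "linear \<phi>" and le: "\<And>x. \<bar>\<phi> x\<bar> \<le> norm x"
    and z: "\<And>x. x \<in> span (delta ` K) \<Longrightarrow> \<phi> x = 0" and nz: "\<phi> \<mu> \<noteq> 0"
    unfolding free_space_def using subspace_separation[OF subspace_span] by metis
  have delta_lip: "norm (delta x - delta y) \<le> dist x y" for x y :: 'a
  proof (rule norm_blinfun_bound)
    show "norm (blinfun_apply (delta x - delta y) f) \<le> dist x y * norm f" for f
      using lipschitz_onD[OF lip0_lipschitz, of x y f]
      by (simp add: blinfun.diff_left delta.rep_eq dist_real_def mult.commute)
  qed simp
  have "1-lipschitz_on UNIV (\<lambda>x::'a. \<phi> (delta x))"
  proof (rule lipschitz_onI)
    show "dist (\<phi> (delta x)) (\<phi> (delta y)) \<le> 1 * dist x y" for x y :: 'a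
      using le[of "delta x - delta y"] delta_lip[of x y]
      by (simp add: dist_real_def linear_diff[OF lin])
  qed simp
  then have f: "lip0_apply (Abs_lip0 (\<lambda>x::'a. \<phi> (delta x))) = (\<lambda>x. \<phi> (delta x))"
    by (subst Abs_lip0_inverse) (auto simp: linear_0[OF lin])
  define f where "f = Abs_lip0 (\<lambda>x::'a. \<phi> (delta x))"
  have "blinfun_apply \<mu> f = 0"
    by (rule ann) (simp add: f_def f z span_base)
  \<comment> \<open>Both sides are continuous in the functional and agree at every
    \<open>delta x\<close> by the choice of \<open>f\<close>, hence on the closed span.\<close>
  moreover have "blinfun_apply \<mu> f = \<phi> \<mu>"
  proof -
    have "blinfun_apply \<nu> f = \<phi> \<nu>" if "\<nu> \<in> span (range delta)" for \<nu>
      using that by (induction rule: span_induct_alt)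
        (auto simp: blinfun.zero_left blinfun.add_left blinfun.scaleR_left linear_0[OF lin]
          linear_add[OF lin] linear_scale[OF lin] f_def f delta.rep_eq)
    moreover have "continuous_on UNIV \<phi>"
    proof (rule lipschitz_on_continuous_on[of 1], rule lipschitz_onI)
      show "dist (\<phi> x) (\<phi> y) \<le> 1 * dist x y" for x y
        using le[of "x - y"] by (simp add: dist_real_def dist_norm linear_diff[OF lin])
    qed simp
    then have "closed {\<nu>. blinfun_apply \<nu> f = \<phi> \<nu>}"
      by (intro closed_Collect_eq continuous_intros)
    ultimately have "closure (span (range delta)) \<subseteq> {\<nu>. blinfun_apply \<nu> f = \<phi> \<nu>}"
      by (intro closure_minimal) auto
    then show ?thesis
      using \<mu> by (auto simp: free_space_def)
  qed
  ultimately show False using nz by simp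
qed

subsection \<open>Multipliers and cutoff functions\<close>

text \<open>The weight \<open>min (dist x 0) (dist y 0)\<close> lets \<open>h\<close> vary fast near
  the base point, where functions in \<open>lip0\<close> are small: it is what the product rule
  requires for \<open>h * f\<close> to be Lipschitz.\<close>

definition multiplier :: "real \<Rightarrow> ('a::{metric_space, zero} \<Rightarrow> real) \<Rightarrow> bool" where
  "multiplier L h \<longleftrightarrow> (\<forall>x. 0 \<le> h x \<and> h x \<le> 1) \<and>
    (\<forall>x y. \<bar>h x - h y\<bar> * min (dist x 0) (dist y 0) \<le> L * dist x y)"

definition mult_op :: "('a::{metric_space, zero} \<Rightarrow> real) \<Rightarrow> 'a lip0 \<Rightarrow>\<^sub>L 'a lip0" where
  "mult_op h = Blinfun (\<lambda>f. Abs_lip0 (\<lambda>x. h x * lip0_apply f x))"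

text \<open>Product rule: the difference of \<open>h * f\<close> at \<open>x\<close> and
  \<open>y\<close> splits into \<open>h x\<close> times the increment of \<open>f\<close> and the
  increment of \<open>h\<close> times \<open>f y\<close>. With \<open>y\<close> the point nearer to
  the base, \<open>f y\<close> is at most \<open>norm f * dist y 0\<close> in absolute value and the
  weight in \<open>multiplier\<close> absorbs it.\<close>

lemma
  assumes h: "multiplier L h" and "0 \<le> L"
  shows mult_op_apply: "lip0_apply (blinfun_apply (mult_op h) f) x = h x * lip0_apply f x"
    and norm_mult_op: "norm (mult_op h) \<le> 1 + L"
proof -
  have bound: "\<bar>h x * lip0_apply f x - h y * lip0_apply f y\<bar> \<le> norm f * (1 + L) * dist x y"
    if "dist y 0 \<le> dist x 0" for f x y
  proof -
    have "\<bar>h x * lip0_apply f x - h y * lip0_apply f y\<bar>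
        = \<bar>h x * (lip0_apply f x - lip0_apply f y) + (h x - h y) * lip0_apply f y\<bar>"
      by (simp add: algebra_simps)
    also have "\<dots> \<le> h x * \<bar>lip0_apply f x - lip0_apply f y\<bar> + \<bar>h x - h y\<bar> * \<bar>lip0_apply f y\<bar>"
      using h by (intro order_trans[OF abs_triangle_ineq]) (simp add: abs_mult multiplier_def)
    also have "\<dots> \<le> 1 * (norm f * dist x y) + \<bar>h x - h y\<bar> * (norm f * dist y 0)"
      using h lipschitz_onD[OF lip0_lipschitz, of x y f] lip0_apply_le[of f y]
      by (intro add_mono mult_mono) (auto simp: multiplier_def dist_real_def)
    also have "\<bar>h x - h y\<bar> * (norm f * dist y 0) = norm f * (\<bar>h x - h y\<bar> * min (dist x 0) (dist y 0))"
      using that by (simp add: min_def)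
    also have "\<dots> \<le> norm f * (L * dist x y)"
      using h by (intro mult_left_mono) (auto simp: multiplier_def)
    finally show ?thesis by (simp add: algebra_simps)
  qed
  have lip: "(norm f * (1 + L))-lipschitz_on UNIV (\<lambda>x. h x * lip0_apply f x)" for f
  proof (rule lipschitz_onI)
    show "dist (h x * lip0_apply f x) (h y * lip0_apply f y) \<le> norm f * (1 + L) * dist x y" for x y
      using bound[of y x f] bound[of x y f]
      by (cases "dist y 0 \<le> dist x 0") (auto simp: dist_real_def dist_commute abs_minus_commute)
  qed (use \<open>0 \<le> L\<close> in simp)
  define W where "W f = Abs_lip0 (\<lambda>x. h x * lip0_apply f x)" for f
  have app: "lip0_apply (W f) = (\<lambda>x. h x * lip0_apply f x)" for f
    unfolding W_def using lip by (subst Abs_lip0_inverse) auto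
  have norm: "norm (W f) \<le> norm f * (1 + L)" for f
    by (rule norm_lip0_le) (simp only: app lip)
  have "bounded_linear W"
    by (rule bounded_linear_intro[OF _ _ norm])
      (auto intro!: lip0_eqI simp: app plus_lip0.rep_eq scaleR_lip0.rep_eq algebra_simps)
  then have M: "blinfun_apply (mult_op h) = W"
    unfolding mult_op_def W_def by (simp add: bounded_linear_Blinfun_apply)
  show "lip0_apply (blinfun_apply (mult_op h) f) x = h x * lip0_apply f x"
    by (simp add: M app)
  show "norm (mult_op h) \<le> 1 + L"
    by (rule norm_blinfun_bound) (use norm \<open>0 \<le> L\<close> in \<open>auto simp: M mult.commute\<close>)
qed

text \<open>The scale \<open>d * dist y 0\<close> of the neighbourhood grows with the distance to the base point, so
  the multiplier constant depends neither on \<open>E\<close> nor on its diameter.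
  At \<open>y = 0\<close> the division by zero gives the value \<open>1\<close>.\<close>
definition cutoff :: "real \<Rightarrow> 'a::{metric_space, zero} set \<Rightarrow> 'a \<Rightarrow> real" where
  "cutoff d E y = max 0 (min 1 (2 - infdist y E / (d * dist y 0)))"

lemma cutoff_eq_1:
  assumes "0 < d" "infdist y E \<le> d * dist y 0"
  shows "cutoff d E y = 1"
proof (cases "y = 0")
  case False
  then have "infdist y E / (d * dist y 0) \<le> 1"
    using assms by (simp add: divide_le_eq)
  then show ?thesis unfolding cutoff_def by simp
qed (simp add: cutoff_def)

lemma cutoff_eq_0:
  assumes "0 < d" "0 \<in> E" "2 * d * dist y 0 < infdist y E"
  shows "cutoff d E y = 0"
proof -
  have "y \<noteq> 0" using assms by auto
  then have "2 \<le> infdist y E / (d * dist y 0)"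
    using assms by (simp add: le_divide_eq mult.assoc)
  then show ?thesis unfolding cutoff_def by simp
qed

text \<open>Quotient rule for \<open>infdist y E / (d * dist y 0)\<close>, whose numerator and whose
  factor \<open>dist y 0\<close> are both 1-Lipschitz. At least one of the two ratios may be taken
  to be at most 2, since otherwise both cutoffs vanish; this gives
  \<open>(2 * d + 1) / d\<close>.\<close>

lemma multiplier_cutoff:
  assumes d: "0 < d"
  shows "multiplier (1/d + 2) (cutoff d E)"
proof -
  have *: "\<bar>cutoff d E x - cutoff d E y\<bar> * min (dist x 0) (dist y 0) \<le> (1/d + 2) * dist x y"
    if x: "x \<noteq> 0" and y: "y \<noteq> 0" and le: "infdist x E / (d * dist x 0) \<le> 2" for x y
  proof -
    define a b r s where ab: "a = infdist x E" "b = infdist y E" and rs: "r = dist x 0" "s = dist y 0"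
    have r: "0 < r" "0 < s" using x y by (auto simp: rs)
    have a0: "0 \<le> a" by (simp add: ab infdist_nonneg)
    have D: "\<bar>a - b\<bar> \<le> dist x y" "\<bar>r - s\<bar> \<le> dist x y"
      unfolding ab rs by (rule infdist_triangle_abs, metis abs_dist_diff_le dist_commute)
    have ar: "a / r \<le> 2 * d"
      using le r d by (simp add: ab rs field_simps)
    have "\<bar>cutoff d E x - cutoff d E y\<bar> \<le> \<bar>a / (d * r) - b / (d * s)\<bar>"
      unfolding cutoff_def ab rs by linarith
    \<comment> \<open>Whichever distance is the smaller, the weight is at most \<open>s\<close>, and
      the factor \<open>s\<close> cancels the denominator of the ratio at \<open>y\<close>.\<close>
    then have "\<bar>cutoff d E x - cutoff d E y\<bar> * min r s \<le> \<bar>a / (d * r) - b / (d * s)\<bar> * s"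
      using r by (intro mult_mono) auto
    also have "\<dots> = \<bar>((a / r) * (s - r) + (a - b)) / d\<bar>"
    proof -
      have "(a / (d * r) - b / (d * s)) * s = ((a / r) * (s - r) + (a - b)) / d"
        using r d by (simp add: field_simps)
      then show ?thesis
        using r by (metis abs_mult abs_of_pos)
    qed
    also have "\<dots> = \<bar>(a / r) * (s - r) + (a - b)\<bar> / d"
      using d by (simp add: abs_divide)
    also have "\<dots> \<le> (2 * d * dist x y + dist x y) / d"
    proof (rule divide_right_mono)
      have "\<bar>(a / r) * (s - r)\<bar> \<le> 2 * d * dist x y"
        unfolding abs_mult using ar a0 r d D(2) by (intro mult_mono) (auto simp: abs_minus_commute)
      then show "\<bar>(a / r) * (s - r) + (a - b)\<bar> \<le> 2 * d * dist x y + dist x y"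
        using D(1) by linarith
    qed (use d in simp)
    also have "\<dots> = (1/d + 2) * dist x y"
      using d by (simp add: field_simps)
    finally show ?thesis by (simp add: rs)
  qed
  have "\<bar>cutoff d E x - cutoff d E y\<bar> * min (dist x 0) (dist y 0) \<le> (1/d + 2) * dist x y" for x y
  proof (cases "x = 0 \<or> y = 0")
    case True
    then show ?thesis using d by (auto simp: min_def)
  next
    case False
    consider "infdist x E / (d * dist x 0) \<le> 2" | "infdist y E / (d * dist y 0) \<le> 2"
      | "infdist x E / (d * dist x 0) > 2" "infdist y E / (d * dist y 0) > 2" by linarith
    then show ?thesis
    proof cases
      case 1 then show ?thesis using *[of x y] False by auto
    next
      case 2 then show ?thesis
        using *[of y x] False by (simp add: dist_commute abs_minus_commute min.commute)
    next
      case 3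
      then have "cutoff d E x = 0" "cutoff d E y = 0" unfolding cutoff_def by auto
      then show ?thesis using d by simp
    qed
  qed
  then show ?thesis unfolding multiplier_def by (simp add: cutoff_def)
qed

text \<open>At each of two given points at most one summand is nonzero, so at most two summands
  contribute to the increment.\<close>

lemma norm_disjoint_sum_le:
  fixes g :: "nat \<Rightarrow> 'a::{metric_space, zero} lip0"
  assumes norm: "\<And>k. norm (g k) \<le> C" and "finite A" and \<theta>: "\<And>k. \<bar>\<theta> k\<bar> \<le> 1"
    and disj: "\<And>x j k. lip0_apply (g j) x \<noteq> 0 \<Longrightarrow> lip0_apply (g k) x \<noteq> 0 \<Longrightarrow> j = k"
  shows "norm (\<Sum>k\<in>A. \<theta> k *\<^sub>R g k) \<le> 2 * C"
proof (rule norm_lip0_le, rule lipschitz_onI)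
  have C: "0 \<le> C" using norm[of 0] norm_ge_zero order_trans by blast
  then show "0 \<le> 2 * C" by simp
  fix x y
  define D where "D k = \<bar>lip0_apply (g k) x - lip0_apply (g k) y\<bar>" for k
  define S where "S z = {k\<in>A. lip0_apply (g k) z \<noteq> 0}" for z
  have D: "D k \<le> C * dist x y" for k
  proof -
    have "D k \<le> norm (g k) * dist x y"
      unfolding D_def using lipschitz_onD[OF lip0_lipschitz, of x y "g k"] by (simp add: dist_real_def)
    then show ?thesis using mult_right_mono[OF norm[of k], of "dist x y"] by simp
  qed
  have S: "sum D (S z) \<le> C * dist x y" for z
  proof -
    have "S z = {} \<or> (\<exists>k. S z = {k})"
      unfolding S_def using disj[of _ z] by blast
    then show ?thesis using D C by auto
  qed
  have "dist (lip0_apply (\<Sum>k\<in>A. \<theta> k *\<^sub>R g k) x) (lip0_apply (\<Sum>k\<in>A. \<theta> k *\<^sub>R g k) y)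
      = \<bar>\<Sum>k\<in>A. \<theta> k * (lip0_apply (g k) x - lip0_apply (g k) y)\<bar>"
    by (simp add: lip0_apply_sum scaleR_lip0.rep_eq dist_real_def sum_subtractf right_diff_distrib)
  also have "\<dots> \<le> (\<Sum>k\<in>A. \<bar>\<theta> k * (lip0_apply (g k) x - lip0_apply (g k) y)\<bar>)"
    by (rule sum_abs)
  also have "\<dots> \<le> sum D A"
    unfolding D_def using \<theta> by (intro sum_mono) (simp add: abs_mult mult_left_le_one_le)
  also have "\<dots> = sum D (S x \<union> S y)"
    using \<open>finite A\<close> by (intro sum.mono_neutral_right) (auto simp: S_def D_def)
  also have "\<dots> \<le> sum D (S x) + sum D (S y)"
    using \<open>finite A\<close> sum_nonneg[of "S x \<inter> S y" D] sum_Un[of "S x" "S y" D]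
    by (auto simp: S_def D_def)
  finally show "dist (lip0_apply (\<Sum>k\<in>A. \<theta> k *\<^sub>R g k) x) (lip0_apply (\<Sum>k\<in>A. \<theta> k *\<^sub>R g k) y)
      \<le> 2 * C * dist x y"
    using S[of x] S[of y] by linarith
qed

subsection \<open>Tightness\<close>

text \<open>If a single pair \<open>\<mu>\<close>, \<open>f\<close> violates the estimate, then \<open>f\<close> can be cut down to a
  neighbourhood of the finite support \<open>F\<close> of an approximation of \<open>\<mu>\<close>.\<close>
lemma localize_functional:
  fixes \<mu> :: "'a::{metric_space, zero} lip0 \<Rightarrow>\<^sub>L real"
  assumes \<mu>: "\<mu> \<in> free_space UNIV" and "0 < d" "0 < e"
    and f: "norm f \<le> 1" "e < \<bar>blinfun_apply \<mu> f\<bar>"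
  obtains F g where "finite F" "0 \<in> F" "norm g \<le> 3 + 2/d" "e/2 \<le> \<bar>blinfun_apply \<mu> g\<bar>"
    "\<And>x. lip0_apply g x \<noteq> 0 \<Longrightarrow> infdist x F \<le> d * dist x 0"
    "\<And>x. lip0_apply f x = 0 \<Longrightarrow> lip0_apply g x = 0"
proof -
  \<comment> \<open>This is \<open>1 + L\<close> for the multiplier constant \<open>L\<close> of a
    cutoff with parameter \<open>d/2\<close>. The parameter is halved because the support reaches
    out to twice its value.\<close>
  define C where "C = 3 + 2/d"
  have C: "0 < C" using \<open>0 < d\<close> by (simp add: C_def add_pos_pos)
  then have "0 < e / (2 * (1 + C))" using \<open>0 < e\<close> by simp
  then obtain F \<nu> where F: "finite F" and \<nu>: "\<nu> \<in> span (delta ` F)"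
    and \<mu>\<nu>: "norm (\<mu> - \<nu>) < e / (2 * (1 + C))"
    using free_space_approx[OF \<mu>] by metis
  define h where "h = cutoff (d/2) (insert 0 F)"
  have h: "multiplier (1/(d/2) + 2) h" "0 \<le> 1/(d/2) + 2"
    unfolding h_def using \<open>0 < d\<close> multiplier_cutoff[of "d/2"] by simp_all
  define g where "g = blinfun_apply (mult_op h) f"
  have g: "lip0_apply g x = h x * lip0_apply f x" for x
    unfolding g_def by (rule mult_op_apply[OF h])
  have "norm g \<le> norm (mult_op h) * norm f"
    unfolding g_def by (rule norm_blinfun)
  also have "\<dots> \<le> C * 1"
    using norm_mult_op[OF h] f(1) C by (intro mult_mono) (auto simp: C_def)
  finally have normg: "norm g \<le> C" by simp
  \<comment> \<open>The cutoff equals 1 on \<open>F\<close>, so \<open>\<nu>\<close> does not see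
    the change from \<open>f\<close> to \<open>g\<close>.\<close>
  have "blinfun_apply \<nu> g = blinfun_apply \<nu> f"
    by (rule span_delta_cong[OF \<nu>]) (use \<open>0 < d\<close> in \<open>simp add: g h_def cutoff_eq_1\<close>)
  then have "blinfun_apply \<mu> f - blinfun_apply \<mu> g = blinfun_apply (\<mu> - \<nu>) (f - g)"
    by (simp add: blinfun.diff_left blinfun.diff_right)
  also have "\<bar>\<dots>\<bar> \<le> norm (\<mu> - \<nu>) * norm (f - g)"
    using norm_blinfun[of "\<mu> - \<nu>" "f - g"] by simp
  also have "\<dots> \<le> e / (2 * (1 + C)) * (1 + C)"
    using \<mu>\<nu> norm_triangle_ineq4[of f g] f(1) normg C \<open>0 < e\<close> by (intro mult_mono) auto
  also have "\<dots> = e/2"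
    using C by (simp add: field_simps)
  finally have "e/2 \<le> \<bar>blinfun_apply \<mu> g\<bar>"
    using f(2) by linarith
  moreover have "infdist x (insert 0 F) \<le> d * dist x 0" if "lip0_apply g x \<noteq> 0" for x
    using that cutoff_eq_0[of "d/2" "insert 0 F" x] \<open>0 < d\<close> by (force simp: g h_def)
  ultimately show thesis
    using that[of "insert 0 F" g] F normg by (simp add: g C_def)
qed

text \<open>Gliding hump: if every \<open>E\<close> fails, enlarge \<open>E\<close> step by step by
  the finite set \<open>F E\<close> around which the localized witness lives. Later witnesses vanish
  on the neighbourhoods of all earlier sets, so the supports are disjoint.\<close>

lemma tight_of_no_ell1:
  fixes X :: "('a::{metric_space, zero} lip0 \<Rightarrow>\<^sub>L real) set"
  assumes X: "X \<subseteq> free_space UNIV" "subspace X" "closed X"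
    and no: "\<not> isomorphic_to_subspace (UNIV :: ell1 set) X" and "0 < d" "0 < e"
  shows "\<exists>E. finite E \<and> 0 \<in> E \<and>
    (\<forall>\<mu>\<in>X. \<forall>f. (\<forall>x. infdist x E \<le> d * dist x 0 \<longrightarrow> lip0_apply f x = 0) \<longrightarrow>
      \<bar>blinfun_apply \<mu> f\<bar> \<le> e * norm \<mu> * norm f)"
proof (rule ccontr)
  assume contr: "\<not> ?thesis"
  have "\<exists>\<mu> F g. \<mu> \<in> X \<and> norm \<mu> \<le> 1 \<and> finite F \<and> 0 \<in> F \<and> norm g \<le> 3 + 2/d \<and>
      e/2 \<le> \<bar>blinfun_apply \<mu> g\<bar> \<and>
      (\<forall>x. lip0_apply g x \<noteq> 0 \<longrightarrow> infdist x F \<le> d * dist x 0 \<and> \<not> infdist x E \<le> d * dist x 0)"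
    if E: "finite E" "0 \<in> E" for E
  proof -
    obtain \<mu> f where \<mu>: "\<mu> \<in> X" and f: "\<And>x. infdist x E \<le> d * dist x 0 \<Longrightarrow> lip0_apply f x = 0"
      and big: "e * norm \<mu> * norm f < \<bar>blinfun_apply \<mu> f\<bar>"
      using contr E by (metis not_le)
    have pos: "0 < norm \<mu>" "0 < norm f"
      using big by (auto simp: blinfun.zero_left blinfun.zero_right)
    define \<mu>' where "\<mu>' = \<mu> /\<^sub>R norm \<mu>"
    define f' where "f' = f /\<^sub>R norm f"
    have \<mu>': "\<mu>' \<in> X" "norm \<mu>' \<le> 1"
      unfolding \<mu>'_def using \<mu> X(2) pos by (auto intro: subspace_scale)
    have f': "norm f' \<le> 1"
      unfolding f'_def using pos by simp
    have "\<bar>blinfun_apply \<mu>' f'\<bar> = \<bar>blinfun_apply \<mu> f\<bar> / (norm \<mu> * norm f)"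
      unfolding \<mu>'_def f'_def
      by (simp add: blinfun.scaleR_left blinfun.scaleR_right abs_mult divide_inverse)
    then have big': "e < \<bar>blinfun_apply \<mu>' f'\<bar>"
      using big pos by (simp add: less_divide_eq mult.assoc)
    have z: "lip0_apply f' x = 0" if "infdist x E \<le> d * dist x 0" for x
      unfolding f'_def by (simp add: scaleR_lip0.rep_eq f[OF that])
    have "\<mu>' \<in> free_space UNIV" using \<mu>' X(1) by blast
    from localize_functional[OF this \<open>0 < d\<close> \<open>0 < e\<close> f' big'] obtain F g where
      "finite F" "0 \<in> F" "norm g \<le> 3 + 2/d" "e/2 \<le> \<bar>blinfun_apply \<mu>' g\<bar>"
      "\<And>x. lip0_apply g x \<noteq> 0 \<Longrightarrow> infdist x F \<le> d * dist x 0"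
      "\<And>x. lip0_apply f' x = 0 \<Longrightarrow> lip0_apply g x = 0" by metis
    then show ?thesis
      using \<mu>' z by (intro exI[of _ \<mu>'] exI[of _ F] exI[of _ g]) blast
  qed
  then obtain m F G where step: "\<And>E. finite E \<Longrightarrow> 0 \<in> E \<Longrightarrow> m E \<in> X \<and> norm (m E) \<le> 1 \<and> finite (F E) \<and>
      0 \<in> F E \<and> norm (G E) \<le> 3 + 2/d \<and> e/2 \<le> \<bar>blinfun_apply (m E) (G E)\<bar> \<and>
      (\<forall>x. lip0_apply (G E) x \<noteq> 0 \<longrightarrow> infdist x (F E) \<le> d * dist x 0 \<and> \<not> infdist x E \<le> d * dist x 0)"
    by metis
  define E where "E = rec_nat {0} (\<lambda>_ B. B \<union> F B)"
  have E_Suc: "E (Suc n) = E n \<union> F (E n)" for n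
    by (simp add: E_def)
  have E: "finite (E n) \<and> 0 \<in> E n" for n
    by (induction n) (use step in \<open>auto simp: E_def\<close>)
  note step = step[OF E[THEN conjunct1] E[THEN conjunct2]]
  have mono: "E i \<subseteq> E j" if "i \<le> j" for i j
    using lift_Suc_mono_le[of E, OF _ that] by (simp add: E_Suc)
  have disj: "\<not> (lip0_apply (G (E j)) x \<noteq> 0 \<and> lip0_apply (G (E k)) x \<noteq> 0)" if "j < k" for j k x
  proof
    assume nz: "lip0_apply (G (E j)) x \<noteq> 0 \<and> lip0_apply (G (E k)) x \<noteq> 0"
    have "F (E j) \<subseteq> E k"
      using mono[of "Suc j" k] \<open>j < k\<close> E_Suc by auto
    then have "infdist x (E k) \<le> infdist x (F (E j))"
      using step[of j] by (intro infdist_mono) auto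
    then show False
      using nz step[of j] step[of k] by fastforce
  qed
  have "isomorphic_to_subspace (UNIV :: ell1 set) X"
  proof (rule almost_biorthogonal_imp_ell1[where g = "\<lambda>n. G (E n)" and \<mu> = "\<lambda>n. m (E n)"
        and e = "e/2" and D = "2 * (3 + 2/d)"])
    fix A :: "nat set" and \<theta> :: "nat \<Rightarrow> real" assume A: "finite A" "\<And>k. \<bar>\<theta> k\<bar> \<le> 1"
    show "norm (\<Sum>k\<in>A. \<theta> k *\<^sub>R G (E k)) \<le> 2 * (3 + 2/d)"
    proof (rule norm_disjoint_sum_le[OF _ A])
      show "j = k" if "lip0_apply (G (E j)) x \<noteq> 0" "lip0_apply (G (E k)) x \<noteq> 0" for x j k
        using disj[of j k x] disj[of k j x] that by (meson linorder_neqE_nat)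
    qed (use step in blast)
  qed (use X step \<open>0 < e\<close> in auto)
  with no show False by blast
qed

subsection \<open>Reduction to a compact set\<close>

text \<open>Weak-star continuity on bounded sequences: finite combinations of evaluations converge
  by \<open>lim\<close>, and the uniform norm bound controls the approximation error.\<close>

lemma free_space_tendsto:
  assumes \<mu>: "\<mu> \<in> free_space N" and norm: "\<And>n. norm (F n) \<le> C"
    and lim: "\<And>x. x \<in> N \<Longrightarrow> (\<lambda>n. lip0_apply (F n) x) \<longlonglongrightarrow> lip0_apply f x"
  shows "(\<lambda>n. blinfun_apply \<mu> (F n)) \<longlonglongrightarrow> blinfun_apply \<mu> f"
proof (rule LIMSEQ_I)
  fix e :: real assume "0 < e"
  define B where "B = C + norm f + 1"
  have "0 \<le> C" using norm[of 0] norm_ge_zero order_trans by blast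
  then have B: "0 < B" by (simp add: B_def add_nonneg_pos)
  then have "0 < e / (2 * B)" using \<open>0 < e\<close> by simp
  then obtain G \<nu> where "G \<subseteq> N" and \<nu>: "\<nu> \<in> span (delta ` G)" and \<mu>\<nu>: "norm (\<mu> - \<nu>) < e / (2 * B)"
    using free_space_approx[OF \<mu>] by metis
  from \<nu> have "(\<lambda>n. blinfun_apply \<nu> (F n)) \<longlonglongrightarrow> blinfun_apply \<nu> f"
  proof (induction rule: span_induct_alt)
    case (step c x y)
    then obtain z where "z \<in> N" "x = delta z"
      using \<open>G \<subseteq> N\<close> by blast
    then have "(\<lambda>n. c * lip0_apply (F n) z + blinfun_apply y (F n)) \<longlonglongrightarrow>
        c * lip0_apply f z + blinfun_apply y f"
      using step.IH by (intro tendsto_add tendsto_mult_left lim)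
    then show ?case
      using \<open>x = delta z\<close> by (simp add: blinfun.add_left blinfun.scaleR_left delta.rep_eq)
  qed (simp add: blinfun.zero_left)
  then obtain n0 where n0: "\<And>n. n \<ge> n0 \<Longrightarrow> \<bar>blinfun_apply \<nu> (F n) - blinfun_apply \<nu> f\<bar> < e/2"
    using LIMSEQ_D[of _ _ "e/2"] \<open>0 < e\<close> by (metis half_gt_zero real_norm_def)
  have "\<bar>blinfun_apply \<mu> (F n) - blinfun_apply \<mu> f\<bar> < e" if "n \<ge> n0" for n
  proof -
    have "\<bar>blinfun_apply (\<mu> - \<nu>) (F n - f)\<bar> \<le> norm (\<mu> - \<nu>) * norm (F n - f)"
      using norm_blinfun[of "\<mu> - \<nu>" "F n - f"] by simp
    also have "\<dots> \<le> e / (2 * B) * B"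
      using \<mu>\<nu> norm_triangle_ineq4[of "F n" f] norm[of n] B \<open>0 < e\<close> by (intro mult_mono) (auto simp: B_def)
    also have "\<dots> = e/2"
      using B by simp
    finally have "\<bar>(blinfun_apply \<mu> (F n) - blinfun_apply \<mu> f)
        - (blinfun_apply \<nu> (F n) - blinfun_apply \<nu> f)\<bar> \<le> e/2"
      by (simp add: blinfun.diff_left blinfun.diff_right algebra_simps)
    then show ?thesis
      using n0[OF that] by linarith
  qed
  then show "\<exists>n0. \<forall>n\<ge>n0. norm (blinfun_apply \<mu> (F n) - blinfun_apply \<mu> f) < e"
    by auto
qed

text \<open>Shrinking values towards 0 by \<open>c\<close> is 1-Lipschitz. It makes a function
  vanish wherever it was at most \<open>c\<close> in absolute value, at a uniform cost of
  \<open>c\<close>.\<close>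

lemma soft_threshold:
  fixes f :: "'a::{metric_space, zero} lip0"
  assumes "0 \<le> c"
  obtains g where "norm g \<le> norm f"
    "\<And>x. lip0_apply g x = lip0_apply f x - max (- c) (min c (lip0_apply f x))"
proof -
  let ?s = "\<lambda>x. lip0_apply f x - max (- c) (min c (lip0_apply f x))"
  have lip: "(norm f)-lipschitz_on UNIV ?s"
  proof (rule lipschitz_onI)
    fix x y
    have "dist (?s x) (?s y) \<le> \<bar>lip0_apply f x - lip0_apply f y\<bar>"
      unfolding dist_real_def by linarith
    also have "\<dots> \<le> norm f * dist x y"
      using lipschitz_onD[OF lip0_lipschitz, of x y f] by (simp add: dist_real_def)
    finally show "dist (?s x) (?s y) \<le> norm f * dist x y" .
  qed simp
  then have app: "lip0_apply (Abs_lip0 ?s) = ?s"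
    using assms by (subst Abs_lip0_inverse) auto
  then have "norm (Abs_lip0 ?s) \<le> norm f"
    by (intro norm_lip0_le) (simp only: lip)
  with app show thesis
    using that[of "Abs_lip0 ?s"] by simp
qed

text \<open>The neighbourhood of index 0 is bounded because \<open>d 0 \<le> 1/2\<close>; on a
  bounded set the relative radii become absolutely small, so the \<open>E k\<close> serve as finite
  nets. The exceptional sets \<open>B\<close> admit sequences that only eventually enter each
  neighbourhood.\<close>

lemma compact_closure_of_nbhds:
  fixes E :: "nat \<Rightarrow> 'a::{complete_space, zero} set"
  assumes E: "\<And>k. finite (E k)" "\<And>k. E k \<noteq> {}"
    and d: "\<And>k. 0 \<le> d k" "d 0 \<le> 1/2" "d \<longlonglongrightarrow> 0"
    and S: "\<And>k. \<exists>B. finite B \<and> S \<subseteq> {y. infdist y (E k) \<le> d k * dist y 0} \<union> B"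
  shows "compact (closure S)"
proof -
  have near: "\<exists>z\<in>E k. dist y z \<le> c" if "infdist y (E k) \<le> c" for y k c
  proof -
    have "infdist y (E k) = Min (dist y ` E k)"
      using E by (simp add: infdist_def cInf_eq_Min)
    moreover have "Min (dist y ` E k) \<in> dist y ` E k"
      using E by (intro Min_in) auto
    ultimately show ?thesis using that by auto
  qed
  obtain R where R: "\<And>z. z \<in> E 0 \<Longrightarrow> dist z 0 \<le> R" and "0 \<le> R"
  proof -
    obtain R where "\<forall>z\<in>E 0. dist 0 z \<le> R"
      using bounded_any_center[of "E 0" 0] finite_imp_bounded[OF E(1)] by auto
    then show thesis
      using that[of "max R 0"] by (simp add: dist_commute le_max_iff_disj)
  qed
  have norm_le: "dist y 0 \<le> 2 * R" if y: "infdist y (E 0) \<le> d 0 * dist y 0" for y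
  proof -
    obtain z where "z \<in> E 0" "dist y z \<le> d 0 * dist y 0"
      using near[OF y] by blast
    moreover have "d 0 * dist y 0 \<le> 1/2 * dist y 0"
      using d(2) by (intro mult_right_mono) auto
    ultimately show ?thesis
      using R[of z] dist_triangle[of y 0 z] by linarith
  qed
  have "\<exists>k. finite k \<and> closure S \<subseteq> (\<Union>x\<in>k. ball x e)" if "0 < e" for e
  proof -
    \<comment> \<open>Points of the bounded part satisfy \<open>dist y 0 \<le> 2 * R\<close>, so
      this choice brings them within \<open>e/2\<close> of \<open>E k\<close>; the summand 1 covers
      \<open>R = 0\<close>.\<close>
    have "\<forall>\<^sub>F k in sequentially. d k < e / (4 * R + 1)"
      using order_tendstoD(2)[OF d(3)] \<open>0 < e\<close> \<open>0 \<le> R\<close> by simp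
    then obtain k where k: "d k < e / (4 * R + 1)"
      by (auto simp: eventually_sequentially)
    obtain B B0 where B: "finite B" "S \<subseteq> {y. infdist y (E k) \<le> d k * dist y 0} \<union> B"
      and B0: "finite B0" "S \<subseteq> {y. infdist y (E 0) \<le> d 0 * dist y 0} \<union> B0"
      using S by meson
    define Q where "Q = E k \<union> B \<union> B0"
    have Q: "finite Q" using B B0 E by (simp add: Q_def)
    have "S \<subseteq> (\<Union>x\<in>Q. cball x (e/2))"
    proof
      fix y assume "y \<in> S"
      show "y \<in> (\<Union>x\<in>Q. cball x (e/2))"
      proof (cases "y \<in> B \<union> B0")
        case True
        then show ?thesis
          using \<open>0 < e\<close> by (intro UN_I[of y]) (auto simp: Q_def)
      next
        case False
        then have y: "infdist y (E k) \<le> d k * dist y 0" "infdist y (E 0) \<le> d 0 * dist y 0"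
          using B B0 \<open>y \<in> S\<close> by auto
        obtain z where z: "z \<in> E k" "dist y z \<le> d k * dist y 0"
          using near[OF y(1)] by blast
        have "d k * dist y 0 \<le> d k * (2 * R)"
          using norm_le[OF y(2)] d(1) by (rule mult_left_mono)
        also have "\<dots> \<le> e / (4 * R + 1) * (2 * R)"
          using k \<open>0 \<le> R\<close> by (intro mult_right_mono) auto
        also have "\<dots> \<le> e/2"
          using \<open>0 \<le> R\<close> \<open>0 < e\<close> by (simp add: field_simps)
        finally show ?thesis
          using z by (intro UN_I[of z]) (auto simp: Q_def dist_commute)
      qed
    qed
    then have "closure S \<subseteq> (\<Union>x\<in>Q. cball x (e/2))"
      using Q by (intro closure_minimal closed_UN) auto
    also have "\<dots> \<subseteq> (\<Union>x\<in>Q. ball x e)"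
      using \<open>0 < e\<close> by force
    finally show ?thesis using Q by blast
  qed
  then show ?thesis
    by (simp add: compact_eq_totally_bounded complete_eq_closed)
qed

lemma compact_reduction:
  fixes X :: "('a::{complete_space, zero} lip0 \<Rightarrow>\<^sub>L real) set"
  assumes X: "X \<subseteq> free_space UNIV" "subspace X"
    and tight: "\<And>d e. 0 < d \<Longrightarrow> 0 < e \<Longrightarrow> \<exists>E. finite E \<and> 0 \<in> E \<and>
      (\<forall>\<mu>\<in>X. \<forall>f. (\<forall>x. infdist x E \<le> d * dist x 0 \<longrightarrow> lip0_apply f x = 0) \<longrightarrow>
        \<bar>blinfun_apply \<mu> f\<bar> \<le> e * norm \<mu> * norm f)"
  obtains K T where "compact K" "T ` X \<subseteq> free_space K"
    "\<And>\<mu> \<nu>. \<mu> \<in> X \<Longrightarrow> \<nu> \<in> X \<Longrightarrow> T (\<mu> + \<nu>) = T \<mu> + T \<nu>"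
    "\<And>c \<mu>. \<mu> \<in> X \<Longrightarrow> T (c *\<^sub>R \<mu>) = c *\<^sub>R T \<mu>"
    "\<And>\<mu>. \<mu> \<in> X \<Longrightarrow> norm (T \<mu> - \<mu>) \<le> norm \<mu> / 2"
proof -
  \<comment> \<open>\<open>C k\<close> bounds the norm of the multiplication by the cutoff at scale
    \<open>d k\<close>, and \<open>P k\<close> that of the product of the first \<open>k\<close> of
    them. Both are known before any \<open>E k\<close> is chosen, so \<open>e k\<close> can be fixed
    to make the \<open>k\<close>-th step cost \<open>(1/2)^(k+2)\<close>.\<close>
  define d :: "nat \<Rightarrow> real" where "d k = (1/2)^(k+2)" for k
  define C where "C k = 3 + 1 / d k" for k
  define P where "P k = (\<Prod>i<k. C i)" for k
  define e where "e k = (1/2)^(k+2) / (P k * (1 + C k))" for k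
  have d: "0 < d k" for k by (simp add: d_def)
  have C: "0 < C k" for k
    unfolding C_def using d[of k] by (simp add: add_pos_pos)
  have P: "0 < P k" for k
    unfolding P_def using C by (intro prod_pos) auto
  have e: "0 < e k" for k
    unfolding e_def using P C by (simp add: add_pos_pos)
  have "\<exists>E. \<forall>k. finite (E k) \<and> 0 \<in> E k \<and>
      (\<forall>\<mu>\<in>X. \<forall>f. (\<forall>x. infdist x (E k) \<le> d k * dist x 0 \<longrightarrow> lip0_apply f x = 0) \<longrightarrow>
        \<bar>blinfun_apply \<mu> f\<bar> \<le> e k * norm \<mu> * norm f)"
    using tight[OF d e] by (intro choice) blast
  then obtain E where E: "\<And>k. finite (E k)" "\<And>k. 0 \<in> E k"
    and small: "\<And>k \<mu> f. \<mu> \<in> X \<Longrightarrow> (\<And>x. infdist x (E k) \<le> d k * dist x 0 \<Longrightarrow> lip0_apply f x = 0) \<Longrightarrow>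
        \<bar>blinfun_apply \<mu> f\<bar> \<le> e k * norm \<mu> * norm f"
    by blast
  \<comment> \<open>The cutoff with parameter \<open>d k\<close> vanishes off the neighbourhood of
    twice that scale.\<close>
  define A where "A k = {y. infdist y (E k) \<le> 2 * d k * dist y 0}" for k
  define K where "K = (\<Inter>k. A k)"
  have closedA: "closed (A k)" for k
    unfolding A_def by (intro closed_Collect_le continuous_intros)
  have compact_closure: "compact (closure S)" if "\<And>k. \<exists>B. finite B \<and> S \<subseteq> A k \<union> B" for S
  proof (rule compact_closure_of_nbhds[where E = E and d = "\<lambda>k. 2 * d k"])
    have "(\<lambda>k. (1/2::real)^k) \<longlonglongrightarrow> 0"
      by (rule LIMSEQ_realpow_zero) auto
    then have "(\<lambda>k. 1/2 * (1/2::real)^k) \<longlonglongrightarrow> 1/2 * 0"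
      by (rule tendsto_mult_left)
    then show "(\<lambda>k. 2 * d k) \<longlonglongrightarrow> 0"
      by (simp add: d_def)
    show "2 * d 0 \<le> 1/2" by (simp add: d_def power2_eq_square)
    show "E k \<noteq> {}" "0 \<le> 2 * d k" for k
      using E(2)[of k] d[of k] by auto
  qed (use E(1) that in \<open>simp_all add: A_def\<close>)
  have "compact (closure K)"
    by (rule compact_closure) (auto simp: K_def)
  moreover have "closed K"
    unfolding K_def using closedA by blast
  ultimately have "compact K" by simp

  define h where "h k = cutoff (d k) (E k)" for k
  have h: "multiplier (1/d k + 2) (h k)" "0 \<le> 1/d k + 2" for k
    unfolding h_def using multiplier_cutoff[OF d] d[of k] by (auto simp: add_nonneg_nonneg)
  have normB: "norm (mult_op (h k)) \<le> C k" for k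
    using norm_mult_op[OF h] by (simp add: C_def)
  define M where "M = rec_nat id_blinfun (\<lambda>k N. N o\<^sub>L mult_op (h k))"
  have M0: "M 0 = id_blinfun" and MSuc: "M (Suc k) = M k o\<^sub>L mult_op (h k)" for k
    by (simp_all add: M_def)
  have M_apply: "lip0_apply (blinfun_apply (M k) f) x = (\<Prod>i<k. h i x) * lip0_apply f x" for k f x
    by (induction k arbitrary: f) (simp_all add: M0 MSuc mult_op_apply[OF h])
  have normM: "norm (M k) \<le> P k" for k
  proof (induction k)
    case 0
    show ?case by (simp add: M0 P_def norm_blinfun_id_le)
  next
    case (Suc k)
    have "norm (M (Suc k)) \<le> norm (M k) * norm (mult_op (h k))"
      unfolding MSuc by (rule norm_blinfun_compose)
    also have "\<dots> \<le> P k * C k"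
      using Suc normB P[of k] by (intro mult_mono) auto
    finally show ?case by (simp add: P_def)
  qed
  have step: "norm ((\<mu> o\<^sub>L M (Suc k)) - (\<mu> o\<^sub>L M k)) \<le> norm \<mu> * (1/2)^(k+2)" if \<mu>: "\<mu> \<in> X" for \<mu> k
  proof (rule norm_blinfun_bound)
    fix f
    \<comment> \<open>This is the increment from \<open>M k\<close> to \<open>M (Suc k)\<close>
      applied to \<open>f\<close>. It vanishes where \<open>h k\<close> is 1, so
      \<open>small\<close> applies to it.\<close>
    define g where "g = blinfun_apply (M k) (blinfun_apply (mult_op (h k)) f - f)"
    have "norm g \<le> norm (M k) * norm (blinfun_apply (mult_op (h k)) f - f)"
      unfolding g_def by (rule norm_blinfun)
    also have "\<dots> \<le> P k * ((1 + C k) * norm f)"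
    proof (rule mult_mono[OF normM])
      have "norm (blinfun_apply (mult_op (h k)) f) \<le> C k * norm f"
        using norm_blinfun mult_right_mono[OF normB, of "norm f"] norm_ge_zero order_trans by blast
      then show "norm (blinfun_apply (mult_op (h k)) f - f) \<le> (1 + C k) * norm f"
        using norm_triangle_ineq4[of "blinfun_apply (mult_op (h k)) f" f]
        by (simp add: algebra_simps)
    qed (use P[of k] in auto)
    finally have g: "norm g \<le> P k * ((1 + C k) * norm f)" .
    have "norm (blinfun_apply ((\<mu> o\<^sub>L M (Suc k)) - (\<mu> o\<^sub>L M k)) f) = \<bar>blinfun_apply \<mu> g\<bar>"
      by (simp add: g_def MSuc blinfun.diff_left blinfun.diff_right)
    also have "\<dots> \<le> e k * norm \<mu> * norm g"
    proof (rule small[OF \<mu>])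
      fix x assume "infdist x (E k) \<le> d k * dist x 0"
      then have "h k x = 1"
        unfolding h_def by (rule cutoff_eq_1[OF d])
      then show "lip0_apply g x = 0"
        by (simp add: g_def M_apply minus_lip0.rep_eq mult_op_apply[OF h])
    qed
    also have "\<dots> \<le> e k * norm \<mu> * (P k * ((1 + C k) * norm f))"
      using g e[of k] by (intro mult_left_mono) auto
    also have "\<dots> = norm \<mu> * (e k * (P k * (1 + C k))) * norm f"
      by (simp only: mult_ac)
    also have "e k * (P k * (1 + C k)) = (1/2)^(k+2)"
      using P[of k] C[of k] by (simp add: e_def)
    finally show "norm (blinfun_apply ((\<mu> o\<^sub>L M (Suc k)) - (\<mu> o\<^sub>L M k)) f)
        \<le> norm \<mu> * (1/2)^(k+2) * norm f" .
  qed simp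
  define T where "T \<mu> = lim (\<lambda>k. \<mu> o\<^sub>L M k)" for \<mu> :: "'a lip0 \<Rightarrow>\<^sub>L real"
  have T: "(\<lambda>k. \<mu> o\<^sub>L M k) \<longlonglongrightarrow> T \<mu>" and T_near: "norm (T \<mu> - \<mu>) \<le> norm \<mu> / 2"
    if \<mu>: "\<mu> \<in> X" for \<mu>
  proof -
    let ?D = "\<lambda>k. (\<mu> o\<^sub>L M (Suc k)) - (\<mu> o\<^sub>L M k)"
    \<comment> \<open>The step costs add up to one half, which keeps \<open>T\<close> bounded below
      on \<open>X\<close>.\<close>
    have geo: "(\<lambda>k. norm \<mu> * (1/2)^(k+2)) sums (norm \<mu> / 2)"
      using sums_mult[OF geometric_sums[of "1/2::real"], of "norm \<mu> / 4"] by (simp add: power2_eq_square)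
    have sm: "summable (\<lambda>k. norm (?D k))"
      by (rule summable_comparison_test'[OF sums_summable[OF geo], where N = 0]) (use step[OF \<mu>] in simp)
    have "(\<lambda>n. (\<Sum>k<n. ?D k) + \<mu>) \<longlonglongrightarrow> suminf ?D + \<mu>"
      by (intro tendsto_intros summable_LIMSEQ summable_norm_cancel[OF sm])
    moreover have "(\<Sum>k<n. ?D k) + \<mu> = \<mu> o\<^sub>L M n" for n
    proof -
      have "\<mu> o\<^sub>L M 0 = \<mu>"
        by (rule blinfun_eqI) (simp add: M0)
      then show ?thesis
        using sum_lessThan_telescope[of "\<lambda>k. \<mu> o\<^sub>L M k" n] by simp
    qed
    ultimately have lim: "(\<lambda>k. \<mu> o\<^sub>L M k) \<longlonglongrightarrow> suminf ?D + \<mu>"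
      by simp
    then have T_eq: "T \<mu> = suminf ?D + \<mu>"
      unfolding T_def by (rule limI)
    show "(\<lambda>k. \<mu> o\<^sub>L M k) \<longlonglongrightarrow> T \<mu>"
      unfolding T_eq by (rule lim)
    have "norm (suminf ?D) \<le> (\<Sum>k. norm (?D k))"
      by (rule summable_norm[OF sm])
    also have "\<dots> \<le> norm \<mu> / 2"
      using suminf_le[OF step[OF \<mu>] sm sums_summable[OF geo]] sums_unique[OF geo] by simp
    finally show "norm (T \<mu> - \<mu>) \<le> norm \<mu> / 2"
      by (simp add: T_eq)
  qed
  have T_free: "T \<mu> \<in> free_space UNIV" if \<mu>: "\<mu> \<in> X" for \<mu>
  proof -
    \<comment> \<open>The adjoint of a multiplication only rescales each \<open>delta x\<close>, so
      it preserves the span and, by continuity, its closure.\<close>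
    have delta: "delta x o\<^sub>L M k = (\<Prod>i<k. h i x) *\<^sub>R delta x" for x k
      by (rule blinfun_eqI) (simp add: delta.rep_eq M_apply blinfun.scaleR_left)
    have "\<nu> o\<^sub>L M k \<in> span (range delta)" if "\<nu> \<in> span (range delta)" for \<nu> k
      using that
    proof (induction rule: span_induct_alt)
      case base
      have "0 o\<^sub>L M k = 0" by (rule blinfun_eqI) (simp add: blinfun.zero_left)
      then show ?case by (simp add: span_zero)
    next
      case (step c \<xi> \<nu>)
      have "(c *\<^sub>R \<xi> + \<nu>) o\<^sub>L M k = c *\<^sub>R (\<xi> o\<^sub>L M k) + (\<nu> o\<^sub>L M k)"
        by (rule blinfun_eqI) (simp add: blinfun.add_left blinfun.scaleR_left)
      moreover have "\<xi> o\<^sub>L M k \<in> span (range delta)"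
        using step.hyps by (force simp: delta intro: span_scale span_base)
      ultimately show ?case
        using step.IH by (simp add: span_add span_scale)
    qed
    moreover have "closed {\<nu>. \<nu> o\<^sub>L M k \<in> free_space UNIV}" for k
    proof -
      have "continuous_on UNIV (\<lambda>\<nu>::'a lip0 \<Rightarrow>\<^sub>L real. \<nu> o\<^sub>L M k)"
        by (intro continuous_intros)
      from closed_vimage[OF closed_free_space this] show ?thesis
        by (simp add: vimage_def)
    qed
    ultimately have "closure (span (range delta)) \<subseteq> {\<nu>. \<nu> o\<^sub>L M k \<in> free_space UNIV}" for k
      by (intro closure_minimal) (auto simp: free_space_def intro: subsetD[OF closure_subset])
    then have "\<mu> o\<^sub>L M k \<in> free_space UNIV" for k
      using \<mu> X(1) by (auto simp: free_space_def)
    then show ?thesis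
      by (rule closed_sequentially[OF closed_free_space _ T[OF \<mu>]])
  qed
  \<comment> \<open>Otherwise there are points \<open>y j\<close> in the first \<open>j\<close>
    neighbourhoods with values of \<open>f\<close> beyond \<open>c\<close>. A cluster point exists
    by compactness and lies in every \<open>A k\<close>, hence in \<open>K\<close>, where
    \<open>f\<close> vanishes.\<close>
  have small_near_K: "\<exists>j. \<forall>y. (\<forall>k<j. y \<in> A k) \<longrightarrow> \<bar>lip0_apply f y\<bar> \<le> c"
    if f: "\<And>x. x \<in> K \<Longrightarrow> lip0_apply f x = 0" and "0 < c" for f c
  proof (rule ccontr)
    assume "\<not> ?thesis"
    then obtain y where y: "\<And>j k. k < j \<Longrightarrow> y j \<in> A k" and big: "\<And>j. c < \<bar>lip0_apply f (y j)\<bar>"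
      by (metis not_le)
    have "compact (closure (range y))"
    proof (rule compact_closure)
      \<comment> \<open>Only the terms of index at most \<open>k\<close> can lie outside
        \<open>A k\<close>.\<close>
      show "\<exists>B. finite B \<and> range y \<subseteq> A k \<union> B" for k
        using y[of k] by (intro exI[of _ "y ` {..k}"]) (force simp: not_less)
    qed
    moreover have "\<forall>n. y n \<in> closure (range y)"
      by (auto intro: subsetD[OF closure_subset])
    ultimately obtain l r where r: "strict_mono r" and l: "(y \<circ> r) \<longlonglongrightarrow> l"
      unfolding compact_def by blast
    have "l \<in> A k" for k
    proof (rule Lim_in_closed_set[OF closedA _ _ l])
      have "\<forall>\<^sub>F n in sequentially. k < n" by (rule eventually_gt_at_top)
      then show "\<forall>\<^sub>F n in sequentially. (y \<circ> r) n \<in> A k"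
        by eventually_elim (simp add: y less_le_trans[OF _ seq_suble[OF r]])
    qed simp
    then have "lip0_apply f l = 0"
      using f by (simp add: K_def)
    moreover have "(\<lambda>n. \<bar>lip0_apply f ((y \<circ> r) n)\<bar>) \<longlonglongrightarrow> \<bar>lip0_apply f l\<bar>"
      by (intro tendsto_rabs continuous_on_tendsto_compose[OF lipschitz_on_continuous_on[OF lip0_lipschitz] l])
        auto
    then have "c \<le> \<bar>lip0_apply f l\<bar>"
      by (rule LIMSEQ_le_const) (use big less_imp_le in auto)
    ultimately show False using \<open>0 < c\<close> by simp
  qed
  have T_ann: "blinfun_apply (T \<mu>) f = 0"
    if \<mu>: "\<mu> \<in> X" and f: "\<And>x. x \<in> K \<Longrightarrow> lip0_apply f x = 0" for \<mu> f
  proof -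
    \<comment> \<open>After thresholding, \<open>g\<close> vanishes on the intersection of finitely
      many \<open>A k\<close>. Off that intersection some factor \<open>h i\<close> is zero, so all
      later products annihilate \<open>g\<close>, and so does \<open>T \<mu>\<close>.\<close>
    have "\<exists>g. norm g \<le> norm f \<and> blinfun_apply (T \<mu>) g = 0 \<and>
        (\<forall>x. \<bar>lip0_apply g x - lip0_apply f x\<bar> \<le> c)" if "0 < c" for c
    proof -
      obtain g where g: "norm g \<le> norm f"
        "\<And>x. lip0_apply g x = lip0_apply f x - max (- c) (min c (lip0_apply f x))"
        using soft_threshold[of c f] \<open>0 < c\<close> less_imp_le by metis
      obtain j where j: "\<And>y. (\<And>k. k < j \<Longrightarrow> y \<in> A k) \<Longrightarrow> \<bar>lip0_apply f y\<bar> \<le> c"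
        using small_near_K[OF f \<open>0 < c\<close>] by blast
      have Mg: "blinfun_apply (M k) g = 0" if "j \<le> k" for k
      proof (rule lip0_eqI)
        fix x
        show "lip0_apply (blinfun_apply (M k) g) x = lip0_apply 0 x"
        proof (cases "\<forall>i<j. x \<in> A i")
          case True
          then have "\<bar>lip0_apply f x\<bar> \<le> c" using j by blast
          then have "lip0_apply g x = 0" unfolding g(2) by linarith
          then show ?thesis by (simp add: M_apply zero_lip0.rep_eq)
        next
          case False
          then obtain i where i: "i < j" "x \<notin> A i" by blast
          then have "h i x = 0"
            unfolding h_def using d E by (intro cutoff_eq_0) (auto simp: A_def)
          then have "(\<Prod>i<k. h i x) = 0"
            using i(1) \<open>j \<le> k\<close> by (intro prod_zero) auto
          then show ?thesis by (simp add: M_apply zero_lip0.rep_eq)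
        qed
      qed
      have "\<forall>\<^sub>F k in sequentially. blinfun_apply (\<mu> o\<^sub>L M k) g = 0"
        using eventually_ge_at_top[of j] by eventually_elim (simp add: Mg)
      moreover have "(\<lambda>k. blinfun_apply (\<mu> o\<^sub>L M k) g) \<longlonglongrightarrow> blinfun_apply (T \<mu>) g"
        by (intro tendsto_intros T[OF \<mu>])
      ultimately have "blinfun_apply (T \<mu>) g = 0"
        using tendsto_eventually LIMSEQ_unique by metis
      moreover have "\<bar>lip0_apply g x - lip0_apply f x\<bar> \<le> c" for x
        unfolding g(2) using \<open>0 < c\<close> by linarith
      ultimately show ?thesis using g(1) by blast
    qed
    then have "\<exists>g. \<forall>n. norm (g n) \<le> norm f \<and> blinfun_apply (T \<mu>) (g n) = 0 \<and>
        (\<forall>x. \<bar>lip0_apply (g n) x - lip0_apply f x\<bar> \<le> inverse (real (Suc n)))"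
      by (intro choice) simp
    then obtain g where g: "\<And>n. norm (g n) \<le> norm f" "\<And>n. blinfun_apply (T \<mu>) (g n) = 0"
      "\<And>n x. \<bar>lip0_apply (g n) x - lip0_apply f x\<bar> \<le> inverse (real (Suc n))"
      by blast
    have "(\<lambda>n. lip0_apply (g n) x) \<longlonglongrightarrow> lip0_apply f x" for x
      by (rule LIM_zero_cancel, rule tendsto_rabs_zero_cancel,
          rule tendsto_sandwich[OF _ _ tendsto_const LIMSEQ_inverse_real_of_nat]) (use g(3) in auto)
    from free_space_tendsto[OF T_free[OF \<mu>] g(1) this] show ?thesis
      by (simp add: g(2) LIMSEQ_const_iff)
  qed
  show thesis
  proof (rule that[OF \<open>compact K\<close>])
    show "T ` X \<subseteq> free_space K"
      using free_space_memI T_free T_ann by blast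
    show "T (\<mu> + \<nu>) = T \<mu> + T \<nu>" if "\<mu> \<in> X" "\<nu> \<in> X" for \<mu> \<nu>
    proof -
      have "(\<mu> + \<nu>) o\<^sub>L M k = (\<mu> o\<^sub>L M k) + (\<nu> o\<^sub>L M k)" for k
        by (rule blinfun_eqI) (simp add: blinfun.add_left)
      then have "(\<lambda>k. (\<mu> + \<nu>) o\<^sub>L M k) \<longlonglongrightarrow> T \<mu> + T \<nu>"
        using tendsto_add[OF T T] that by simp
      then show ?thesis
        using T[OF subspace_add[OF X(2) that]] LIMSEQ_unique by blast
    qed
    show "T (c *\<^sub>R \<mu>) = c *\<^sub>R T \<mu>" if "\<mu> \<in> X" for c \<mu>
    proof -
      have "(c *\<^sub>R \<mu>) o\<^sub>L M k = c *\<^sub>R (\<mu> o\<^sub>L M k)" for k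
        by (rule blinfun_eqI) (simp add: blinfun.scaleR_left)
      then have "(\<lambda>k. (c *\<^sub>R \<mu>) o\<^sub>L M k) \<longlonglongrightarrow> c *\<^sub>R T \<mu>"
        using tendsto_scaleR[OF tendsto_const T] that by simp
      then show ?thesis
        using T[OF subspace_scale[OF X(2) that]] LIMSEQ_unique by blast
    qed
  qed (rule T_near)
qed

theorem theorem2p11:
  fixes X :: "('a::{complete_space, zero} lip0 \<Rightarrow>\<^sub>L real) set"
  assumes "X \<subseteq> free_space (UNIV :: 'a set)"
    and "subspace X"
    and "closed X"
    and "\<not> isomorphic_to_subspace (UNIV :: ell1 set) X"
  shows "\<exists>K :: 'a set. compact K \<and> isomorphic_to_subspace X (free_space K)"
proof -
  obtain K T where K: "compact K" "T ` X \<subseteq> free_space K"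
    and lin: "\<And>\<mu> \<nu>. \<mu> \<in> X \<Longrightarrow> \<nu> \<in> X \<Longrightarrow> T (\<mu> + \<nu>) = T \<mu> + T \<nu>"
      "\<And>c \<mu>. \<mu> \<in> X \<Longrightarrow> T (c *\<^sub>R \<mu>) = c *\<^sub>R T \<mu>"
    and near: "\<And>\<mu>. \<mu> \<in> X \<Longrightarrow> norm (T \<mu> - \<mu>) \<le> norm \<mu> / 2"
    using compact_reduction[OF assms(1,2) tight_of_no_ell1[OF assms]] by blast
  have "isomorphic_to_subspace X (free_space K)"
  \<comment> \<open>\<open>T\<close> differs from the inclusion of \<open>X\<close> by at most half
    the norm, which yields both constants.\<close>
  proof (rule linear_embedding_image[where T = T and m = "1/2" and B = "3/2"])
    fix \<mu> assume "\<mu> \<in> X"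
    then show "1/2 * norm \<mu> \<le> norm (T \<mu>)" "norm (T \<mu>) \<le> 3/2 * norm \<mu>"
      using near[of \<mu>] norm_triangle_ineq3[of "T \<mu>" \<mu>] by linarith+
  qed (use assms(2) K(2) lin in auto)
  then show ?thesis using K(1) by blast
qed

end
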